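(* Let $d,m$ be positive integers with $m\geqslant2$, let $1<p\leqslant2$, let $0<\varepsilon\leqslant1$, let $k\geqslant d$ be an integer, and set \[ C'\coloneqq\exp\Big(\frac{24d\ln m}{(\varepsilon^3/4)^{4d}(p-1)^d}\,k^d\Big). \] Let $n\geqslant C'$ be an integer and let $(\mathcal{V},\lambda)$ be a finite probability space. For every $v\in\mathcal{V}$ let $\boldsymbol{X}_v=\langle X^v_s:s\in\binom{[n]}{d}\rangle$ be a $(1/C')$-spreadable, $d$-dimensional random array on $[n]$ taking values in a set $\mathcal{X}_v$ with $|\mathcal{X}_v|=m$, and assume there exists $\mathcal{S}_v\subseteq\mathcal{X}_v$ with $|\mathcal{S}_v|=|\mathcal{X}_v|-1$ such that for every $a\in\mathcal{S}_v$, \[ \Big|\mathbb{P}\Big(\bigcap_{s\in\mathrm{Box}(d)}[X^v_s=a]\Big)-\prod_{s\in\mathrm{Box}(d)}\mathbb{P}([X^v_s=a])\Big|\leqslant\frac1{C'}. \] Finally, for every $v\in\mathcal{V}$ let $f_v\colon\mathcal{X}_v^{\binom{[n]}{d}}\to\mathbb{R}$ satisfy $\mathbb{E}[f_v(\boldsymbol{X}_v)]=0$ and $\|f_v(\boldsymbol{X}_v)\|_{L_p}=1$. Then there exist $G\subseteq\mathcal{V}$ with $\lambda(G)\geqslant1-\varepsilon$ and an interval $I$ of $[n]$ with $|I|=k$ such that for every $v\in G$ and every $J\subseteq I$ with $|J|\geqslant d$, \[ \mathbb{P}\big(\big|\mathbb{E}[f_v(\boldsymbol{X}_v)\,|\,\mathcal{F}_J]\big|\leqslant\varepsilon\big)\geqslant1-\varepsilon,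 \] where $\mathcal{F}_J$ is the $\sigma$-algebra generated by $\langle X^v_s:s\in\binom{J}{d}\rangle$.
   Context: $[n]=\{1,\dots,n\}$, $\binom{I}{d}$ is the set of $d$-element subsets of $I$. A $d$-dimensional random array $\boldsymbol{X}$ on $[n]$ is $\eta$-spreadable if for all $J,K\subseteq[n]$ with $|J|=|K|\geqslant d$ the laws of the subarrays $\langle X_s:s\in\binom{J}{d}\rangle$ and $\langle X_s:s\in\binom{K}{d}\rangle$ (identified via the increasing bijection $J\to K$) are at total variation distance at most $\eta$. $\mathrm{Box}(d)=\{s\in\binom{[n]}{d}:|s\cap\{2i-1,2i\}|=1\ \forall i\in[d]\}$. An interval is a set of consecutive integers. *)

theory Defs
  imports "HOL-Probability.Probability"
begin

definition nsubsets :: "nat set \<Rightarrow> nat \<Rightarrow> nat set set" where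
  "nsubsets I d = {s. s \<subseteq> I \<and> card s = d}"

text \<open>A d-dimensional array on [n] is a function on nat set; entries outside
  the index set are irrelevant and are normalised to undefined.\<close>
definition restr_arr :: "nat set \<Rightarrow> nat \<Rightarrow> (nat set \<Rightarrow> 'a) \<Rightarrow> (nat set \<Rightarrow> 'a)" where
  "restr_arr J d \<omega> = (\<lambda>s. if s \<in> nsubsets J d then \<omega> s else undefined)"

definition enum_set :: "nat set \<Rightarrow> nat \<Rightarrow> nat" where
  "enum_set J i = sorted_list_of_set J ! (i - 1)"

definition subarray :: "nat set \<Rightarrow> nat \<Rightarrow> (nat set \<Rightarrow> 'a) \<Rightarrow> (nat set \<Rightarrow> 'a)" where
  "subarray J d \<omega> = (\<lambda>t. if t \<in> nsubsets {1..card J} d then \<omega> (enum_set J ` t) else undefined)"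

definition tv_dist :: "'b pmf \<Rightarrow> 'b pmf \<Rightarrow> real" where
  "tv_dist P Q = (SUP A. \<bar>measure_pmf.prob P A - measure_pmf.prob Q A\<bar>)"

definition spreadable :: "real \<Rightarrow> nat \<Rightarrow> nat \<Rightarrow> (nat set \<Rightarrow> 'a) pmf \<Rightarrow> bool" where
  "spreadable \<eta> n d X \<longleftrightarrow>
     (\<forall>J K. J \<subseteq> {1..n} \<longrightarrow> K \<subseteq> {1..n} \<longrightarrow> card J = card K \<longrightarrow> card J \<ge> d \<longrightarrow>
        tv_dist (map_pmf (subarray J d) X) (map_pmf (subarray K d) X) \<le> \<eta>)"

definition random_array :: "nat \<Rightarrow> nat \<Rightarrow> 'a set \<Rightarrow> (nat set \<Rightarrow> 'a) pmf \<Rightarrow> bool" where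
  "random_array n d A X \<longleftrightarrow>
     (\<forall>\<omega>\<in>set_pmf X. restr_arr {1..n} d \<omega> = \<omega> \<and> (\<forall>s\<in>nsubsets {1..n} d. \<omega> s \<in> A))"

definition Box :: "nat \<Rightarrow> nat \<Rightarrow> nat set set" where
  "Box n d = {s \<in> nsubsets {1..n} d. \<forall>i\<in>{1..d}. card (s \<inter> {2*i-1, 2*i}) = 1}"

text \<open>Conditional expectation of F given the sigma-algebra generated by a
  discrete random variable g, evaluated at outcome \<omega> (elementary formula,
  valid on the support of P).\<close>
definition cond_exp_disc :: "'b pmf \<Rightarrow> ('b \<Rightarrow> real) \<Rightarrow> ('b \<Rightarrow> 'c) \<Rightarrow> 'b \<Rightarrow> real" where
  "cond_exp_disc P F g \<omega> =
     measure_pmf.expectation P (\<lambda>\<omega>'. indicator {\<omega>'. g \<omega>' = g \<omega>} \<omega>' * F \<omega>')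
     / measure_pmf.prob P {\<omega>'. g \<omega>' = g \<omega>}"

end

theory Submission
  imports Defs
begin

text \<open>
  Box independence forces quasirandomness: among arrays with given marginals, the probability of a monochromatic
  box is (nearly) minimised, so the box norm of each centred indicator is small. By the
  Gowers--Cauchy--Schwarz inequality and spreadability, the entries indexed by \<open>{1..N * k}\<close> are then nearly
  independent, where \<open>N\<close> is of order \<open>1 / ((p - 1) * \<epsilon> ^ 6)\<close>. Split \<open>{1..N * k}\<close> into \<open>N\<close> intervals of length \<open>k\<close>.
  The sum of the \<open>L\<^sub>1\<close> norms of the conditional expectations of \<open>f\<close> on these intervals equals the expectation of
  \<open>f * \<Phi>\<close>, where \<open>\<Phi>\<close> is a sum of \<open>N\<close> centred, bounded, nearly independent variables. As \<open>\<Phi>\<close> is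
  subgaussian, its norm in \<open>L\<^sub>q\<close>, for \<open>q\<close> conjugate to \<open>p\<close>, is of order \<open>sqrt (q * N)\<close>, so this sum is at most
  \<open>N * \<epsilon> ^ 3\<close>. Averaging over \<open>v\<close> yields one interval that is good for most \<open>v\<close>.
\<close>

text \<open>Duality shifts the burden to \<open>\<Phi>\<close>, which must then have a moment of the
  large order \<open>p / (p - 1)\<close>. That moment comes from an exponential one, and for this
  the blocks must be nearly independent jointly, not only in pairs. The decoupling error is
  therefore multiplied by the number of joint values, \<open>m ^ (N * (k choose d))\<close>, which
  accounts for the factor \<open>k ^ d * ln m\<close> in the exponent of the lower bound on
  \<open>n\<close>. A further factor \<open>8 ^ d\<close> is lost there: counting boxes takes a root
  of order \<open>4 ^ d\<close> of the error, and the Gowers--Cauchy--Schwarz inequality one of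
  order \<open>2 ^ d\<close>. The cube of \<epsilon> pays for three things: the exceptional set of
  \<open>v\<close>, the exceptional set of outcomes, and the threshold.\<close>

subsection \<open>Averaging functionals\<close>

text \<open>An abstract expectation. Additivity is required for all functions, so the expectation of a
  probability mass function is an instance only when its support is finite; positivity is only tested on \<open>S\<close>.\<close>

locale averaging =
  fixes S :: "'g set" and \<Lambda> :: "('g \<Rightarrow> real) \<Rightarrow> real"
  assumes add: "\<Lambda> (\<lambda>g. h1 g + h2 g) = \<Lambda> h1 + \<Lambda> h2"
    and scale: "\<Lambda> (\<lambda>g. c * h g) = c * \<Lambda> h"
    and nonneg: "(\<And>g. g \<in> S \<Longrightarrow> 0 \<le> h g) \<Longrightarrow> 0 \<le> \<Lambda> h"
    and one: "\<Lambda> (\<lambda>_. 1) = 1"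
begin

lemma diff: "\<Lambda> (\<lambda>g. h1 g - h2 g) = \<Lambda> h1 - \<Lambda> h2"
  using add[of h1 "\<lambda>g. (-1) * h2 g"] scale[of "-1" h2] by simp

lemma const: "\<Lambda> (\<lambda>_. c) = c"
  using scale[of c "\<lambda>_. 1"] one by simp

lemma mono: "(\<And>g. g \<in> S \<Longrightarrow> h1 g \<le> h2 g) \<Longrightarrow> \<Lambda> h1 \<le> \<Lambda> h2"
  using nonneg[of "\<lambda>g. h2 g - h1 g"] diff[of h2 h1] by simp

lemma cong: "(\<And>g. g \<in> S \<Longrightarrow> h1 g = h2 g) \<Longrightarrow> \<Lambda> h1 = \<Lambda> h2"
  by (intro order_antisym mono) auto

lemma sum: "\<Lambda> (\<lambda>g. \<Sum>i\<in>A. h i g) = (\<Sum>i\<in>A. \<Lambda> (h i))"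
  by (induction A rule: infinite_finite_induct) (simp_all add: const add)

lemma upper: "(\<And>g. g \<in> S \<Longrightarrow> h g \<le> c) \<Longrightarrow> \<Lambda> h \<le> c"
  using mono[of h "\<lambda>_. c"] const[of c] by simp

lemma lower: "(\<And>g. g \<in> S \<Longrightarrow> c \<le> h g) \<Longrightarrow> c \<le> \<Lambda> h"
  using mono[of "\<lambda>_. c" h] const[of c] by simp

lemma abs_le: "\<bar>\<Lambda> h\<bar> \<le> \<Lambda> (\<lambda>g. \<bar>h g\<bar>)"
proof -
  have "\<Lambda> h \<le> \<Lambda> (\<lambda>g. \<bar>h g\<bar>)" "\<Lambda> (\<lambda>g. (-1) * h g) \<le> \<Lambda> (\<lambda>g. \<bar>h g\<bar>)"
    by (rule mono, simp)+
  then show ?thesis unfolding scale by simp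
qed

lemma second_moment: "\<Lambda> (\<lambda>g. (h g - c)\<^sup>2) = \<Lambda> (\<lambda>g. (h g)\<^sup>2) - 2 * c * \<Lambda> h + c\<^sup>2"
proof -
  have "\<Lambda> (\<lambda>g. (h g - c)\<^sup>2) = \<Lambda> (\<lambda>g. (h g)\<^sup>2 - 2 * c * h g + c\<^sup>2)"
    by (rule cong) (simp add: power2_diff)
  also have "\<dots> = \<Lambda> (\<lambda>g. (h g)\<^sup>2) - 2 * c * \<Lambda> h + c\<^sup>2"
    by (simp only: add diff scale const)
  finally show ?thesis .
qed

lemma square_le: "(\<Lambda> h)\<^sup>2 \<le> \<Lambda> (\<lambda>g. (h g)\<^sup>2)"
proof -
  have "0 \<le> \<Lambda> (\<lambda>g. (h g - \<Lambda> h)\<^sup>2)" by (rule nonneg) simp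
  then show ?thesis unfolding second_moment by (simp add: power2_eq_square)
qed

text \<open>Jensen for the exponents that \<open>d\<close> Cauchy--Schwarz steps produce, by
  iterating \<open>square_le\<close>; after the first square everything is nonnegative, so
  \<open>h\<close> may change sign.\<close>

lemma power_le: "(\<Lambda> h) ^ (2 ^ j) \<le> \<Lambda> (\<lambda>g. h g ^ (2 ^ j))"
proof (induction j arbitrary: h)
  case 0
  then show ?case by simp
next
  case (Suc j)
  have "(\<Lambda> h) ^ (2 ^ Suc j) = ((\<Lambda> h)\<^sup>2) ^ (2 ^ j)" by (simp add: power_mult)
  also have "\<dots> \<le> (\<Lambda> (\<lambda>g. (h g)\<^sup>2)) ^ (2 ^ j)" by (intro power_mono square_le) simp
  also have "\<dots> \<le> \<Lambda> (\<lambda>g. ((h g)\<^sup>2) ^ (2 ^ j))" by (rule Suc.IH)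
  finally show ?case by (simp add: power_mult)
qed

lemma L1_le:
  assumes "\<Lambda> (\<lambda>g. (h g - c)\<^sup>2) \<le> s\<^sup>2" "0 \<le> s"
  shows "\<Lambda> (\<lambda>g. \<bar>h g - c\<bar>) \<le> s"
proof (rule power2_le_imp_le)
  show "(\<Lambda> (\<lambda>g. \<bar>h g - c\<bar>))\<^sup>2 \<le> s\<^sup>2"
    using square_le[of "\<lambda>g. \<bar>h g - c\<bar>"] assms(1) by simp
qed fact

lemma map:
  assumes "\<And>g. g \<in> S \<Longrightarrow> \<phi> g \<in> T"
  shows "averaging T (\<lambda>h. \<Lambda> (\<lambda>g. h (\<phi> g)))"
  by unfold_locales (simp_all add: add scale one nonneg assms)

text \<open>In \<open>box_counting\<close>, freezing or doubling a coordinate replaces the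
  functional by a mixture; closure under mixtures is what allows the induction hypothesis to be
  applied to it.\<close>

lemma bind:
  fixes T :: "'t set"
  assumes K: "\<And>g. g \<in> S \<Longrightarrow> averaging T (K g)"
  shows "averaging T (\<lambda>h. \<Lambda> (\<lambda>g. K g h))"
proof
  fix h1 h2 :: "'t \<Rightarrow> real"
  show "\<Lambda> (\<lambda>g. K g (\<lambda>x. h1 x + h2 x)) = \<Lambda> (\<lambda>g. K g h1) + \<Lambda> (\<lambda>g. K g h2)"
    unfolding add[symmetric] by (rule cong) (rule averaging.add[OF K])
next
  fix c :: real and h :: "'t \<Rightarrow> real"
  show "\<Lambda> (\<lambda>g. K g (\<lambda>x. c * h x)) = c * \<Lambda> (\<lambda>g. K g h)"
    unfolding scale[symmetric] by (rule cong) (rule averaging.scale[OF K])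
next
  fix h :: "'t \<Rightarrow> real"
  assume "\<And>x. x \<in> T \<Longrightarrow> 0 \<le> h x"
  then show "0 \<le> \<Lambda> (\<lambda>g. K g h)"
    by (intro nonneg averaging.nonneg[OF K])
next
  show "\<Lambda> (\<lambda>g. K g (\<lambda>_. 1)) = 1"
    using cong[of "\<lambda>g. K g (\<lambda>_. 1)" "\<lambda>_. 1"] one by (simp add: averaging.one[OF K])
qed

lemma pair:
  assumes "averaging T K"
  shows "averaging (S \<times> T) (\<lambda>h. \<Lambda> (\<lambda>g. K (\<lambda>x. h (g, x))))"
  by (rule bind[where K = "\<lambda>g h. K (\<lambda>x. h (g, x))"]) (rule averaging.map[OF assms], simp)

end

section \<open>Uniform averages over a finite set and over its powers\<close>

definition avg :: "'a set \<Rightarrow> ('a \<Rightarrow> real) \<Rightarrow> real" where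
  "avg A h = (\<Sum>x\<in>A. h x) / card A"

lemma averaging_avg:
  assumes "finite A" "A \<noteq> {}"
  shows "averaging A (avg A)"
  using assms
  by unfold_locales
     (auto simp: avg_def sum.distrib add_divide_distrib sum_distrib_left[symmetric]
           intro!: divide_nonneg_nonneg sum_nonneg)

lemma avg_swap: "avg A (\<lambda>x. avg B (\<lambda>y. h x y)) = avg B (\<lambda>y. avg A (\<lambda>x. h x y))"
  unfolding avg_def sum_divide_distrib[symmetric]
  by (subst sum.swap) (simp add: mult.commute)

lemma avg_Times: "avg (A \<times> B) h = avg A (\<lambda>x. avg B (\<lambda>y. h (x, y)))"
  by (simp add: avg_def sum_divide_distrib[symmetric] sum.cartesian_product card_cartesian_product
      mult.commute)

lemma avg_scale: "avg A (\<lambda>x. c * h x) = c * avg A h"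
  by (simp add: avg_def sum_distrib_left[symmetric])

lemma avg_mult: "avg A f * avg B g = avg A (\<lambda>x. avg B (\<lambda>y. f x * g y))"
  using avg_scale[of A "avg B g" f] by (simp add: avg_scale mult.commute)

text \<open>The uniform average over \<open>A ^ d\<close>, encoded recursively so that inductions on
  \<open>d\<close> can peel off the head coordinate.\<close>

primrec lavg :: "nat \<Rightarrow> 'a set \<Rightarrow> ('a list \<Rightarrow> real) \<Rightarrow> real" where
  "lavg 0 A h = h []"
| "lavg (Suc d) A h = avg A (\<lambda>u. lavg d A (\<lambda>l. h (u # l)))"

definition nlists :: "nat \<Rightarrow> 'a set \<Rightarrow> 'a list set" where
  "nlists d A = {l. set l \<subseteq> A \<and> length l = d}"

lemma averaging_lavg:
  assumes "finite A" "A \<noteq> {}"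
  shows "averaging (nlists d A) (lavg d A)"
proof (induction d)
  case 0
  show ?case by unfold_locales (auto simp: nlists_def)
next
  case (Suc d)
  have "averaging (nlists (Suc d) A) (\<lambda>h. avg A (\<lambda>u. lavg d A (\<lambda>l. h (u # l))))"
    by (rule averaging.bind[OF averaging_avg[OF assms]], rule averaging.map[OF Suc])
       (auto simp: nlists_def)
  then show ?case by simp
qed

lemma avg_lavg_swap: "avg B (\<lambda>x. lavg d A (\<lambda>l. h x l)) = lavg d A (\<lambda>l. avg B (\<lambda>x. h x l))"
proof (induction d arbitrary: h)
  case 0
  then show ?case by simp
next
  case (Suc d)
  show ?case by (simp add: Suc.IH[symmetric] avg_swap[of B])
qed

subsection \<open>The Gowers--Cauchy--Schwarz inequality\<close>

definition cube :: "nat \<Rightarrow> bool list set" where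
  "cube d = {e. length e = d}"

lemma cube_0 [simp]: "cube 0 = {[]}"
  by (auto simp: cube_def)

lemma cube_Suc: "cube (Suc d) = (#) False ` cube d \<union> (#) True ` cube d"
  by (auto simp: cube_def length_Suc_conv image_iff)

lemma finite_cube [simp]: "finite (cube d)"
  by (induction d) (simp_all add: cube_Suc)

lemma card_cube: "card (cube d) = 2 ^ d"
proof (induction d)
  case (Suc d)
  then show ?case
    by (simp add: cube_Suc, subst card_Un_disjoint) (auto simp: card_image)
qed simp

lemma prod_cube_Suc: "(\<Prod>e\<in>cube (Suc d). h e) = (\<Prod>e\<in>cube d. h (False # e) * (h (True # e) :: real))"
  unfolding cube_Suc
  by (subst prod.union_disjoint) (auto simp: prod.reindex prod.distrib)

definition sel :: "bool list \<Rightarrow> ('a \<times> 'a) list \<Rightarrow> 'a list" where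
  "sel e vs = map2 (\<lambda>b v. if b then snd v else fst v) e vs"

lemma sel_simps [simp]:
  "sel [] [] = []"
  "sel (b # e) (v # vs) = (if b then snd v else fst v) # sel e vs"
  by (simp_all add: sel_def)

text \<open>The Gowers inner product of the \<open>2 ^ d\<close> functions \<open>G e\<close>: the average runs over pairs
  of points of \<open>W ^ d\<close>, and \<open>sel e\<close> picks the corner \<open>e\<close> of the box they span. Degenerate boxes are included.\<close>

definition gip :: "nat \<Rightarrow> 'a set \<Rightarrow> (bool list \<Rightarrow> 'a list \<Rightarrow> real) \<Rightarrow> real" where
  "gip d W G = lavg d (W \<times> W) (\<lambda>vs. \<Prod>e\<in>cube d. G e (sel e vs))"

lemma gip_0 [simp]: "gip 0 W G = G [] []"
  by (simp add: gip_def)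

lemma gip_Suc:
  "gip (Suc d) W G = avg W (\<lambda>u. avg W (\<lambda>u'. gip d W (\<lambda>e l. G (False # e) (u # l) * G (True # e) (u' # l))))"
  by (simp add: gip_def prod_cube_Suc avg_Times)

text \<open>With the other coordinates fixed, the two choices of the head are independent, so their
  average factors. When \<open>G\<close> ignores the corner the integrand is a square, which links
  box counts in dimension \<open>Suc d\<close> to second moments.\<close>

lemma gip_Suc_square:
  "gip (Suc d) W G = lavg d (W \<times> W) (\<lambda>vs.
     avg W (\<lambda>u. \<Prod>e\<in>cube d. G (False # e) (u # sel e vs)) *
     avg W (\<lambda>u. \<Prod>e\<in>cube d. G (True # e) (u # sel e vs)))"
  by (simp add: gip_def prod_cube_Suc avg_Times avg_mult prod.distrib avg_lavg_swap del: lavg.simps)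
     (simp add: avg_Times avg_lavg_swap prod_cube_Suc prod.distrib)

text \<open>One Cauchy--Schwarz step per coordinate. \<open>B 0\<close> does not see the head, so it
  leaves the inner average and is dropped because it is bounded by 1. Squaring the inner average
  doubles the head, and the remaining factors become products of two copies that are still bounded
  by 1 and still ignore their own coordinate.\<close>

lemma gowers_cauchy_schwarz:
  fixes B :: "nat \<Rightarrow> 'a list \<Rightarrow> real"
  assumes W: "finite W" "W \<noteq> {}"
    and "\<And>i l. i < d \<Longrightarrow> \<bar>B i l\<bar> \<le> 1"
    and "\<And>i l x. i < d \<Longrightarrow> B i (l[i := x]) = B i l"
  shows "(lavg d W (\<lambda>l. g l * (\<Prod>i<d. B i l))) ^ (2 ^ d) \<le> gip d W (\<lambda>_. g)"
  using assms(3,4)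
proof (induction d arbitrary: g B)
  case 0
  then show ?case by simp
next
  case (Suc d)
  interpret L: averaging "nlists d W" "lavg d W" by (rule averaging_lavg[OF W])
  interpret A: averaging W "avg W" by (rule averaging_avg[OF W])
  obtain w where "w \<in> W" using W by auto
  define b where "b l = B 0 (w # l)" for l
  define r where "r u l = g (u # l) * (\<Prod>i<d. B (Suc i) (u # l))" for u l
  have b: "B 0 (u # l) = b l" for u l
    using Suc.prems(2)[of 0 "u # l" w] by (simp add: b_def)
  have "lavg (Suc d) W (\<lambda>l. g l * (\<Prod>i<Suc d. B i l)) = lavg d W (\<lambda>l. avg W (\<lambda>u. b l * r u l))"
    unfolding avg_lavg_swap[symmetric]
    by (simp add: prod.lessThan_Suc_shift b r_def mult_ac del: prod.lessThan_Suc)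
  then have "(lavg (Suc d) W (\<lambda>l. g l * (\<Prod>i<Suc d. B i l)))\<^sup>2
      \<le> lavg d W (\<lambda>l. (b l * avg W (\<lambda>u. r u l))\<^sup>2)"
    using L.square_le[of "\<lambda>l. b l * avg W (\<lambda>u. r u l)"] by (simp add: avg_scale)
  also have "\<dots> \<le> lavg d W (\<lambda>l. (avg W (\<lambda>u. r u l))\<^sup>2)"
  proof (rule L.mono)
    fix l
    have "(b l)\<^sup>2 \<le> 1" using Suc.prems(1)[of 0] by (simp add: b_def abs_square_le_1)
    then show "(b l * avg W (\<lambda>u. r u l))\<^sup>2 \<le> (avg W (\<lambda>u. r u l))\<^sup>2"
      by (simp add: power_mult_distrib mult_left_le_one_le)
  qed
  also have "\<dots> = avg W (\<lambda>u. avg W (\<lambda>u'. lavg d W (\<lambda>l. r u l * r u' l)))"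
    by (simp add: power2_eq_square avg_mult avg_lavg_swap)
  finally have *: "(lavg (Suc d) W (\<lambda>l. g l * (\<Prod>i<Suc d. B i l)))\<^sup>2
      \<le> avg W (\<lambda>u. avg W (\<lambda>u'. lavg d W (\<lambda>l. r u l * r u' l)))" .
  have "(lavg (Suc d) W (\<lambda>l. g l * (\<Prod>i<Suc d. B i l))) ^ (2 ^ Suc d)
      \<le> (avg W (\<lambda>u. avg W (\<lambda>u'. lavg d W (\<lambda>l. r u l * r u' l)))) ^ (2 ^ d)"
    using power_mono[OF *, of "2 ^ d"] by (simp add: power_mult)
  \<comment> \<open>Jensen moves the outer power inside, so that the induction hypothesis can be
    used for each fixed pair of heads \<open>u\<close>, \<open>u'\<close>.\<close>
  also have "\<dots> \<le> avg W (\<lambda>u. avg W (\<lambda>u'. (lavg d W (\<lambda>l. r u l * r u' l)) ^ (2 ^ d)))"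
    by (rule order_trans[OF A.power_le]) (intro A.mono A.power_le)
  also have "\<dots> \<le> avg W (\<lambda>u. avg W (\<lambda>u'. gip d W (\<lambda>_ l. g (u # l) * g (u' # l))))"
  proof (intro A.mono)
    fix u u'
    have "(lavg d W (\<lambda>l. (g (u # l) * g (u' # l)) * (\<Prod>i<d. B (Suc i) (u # l) * B (Suc i) (u' # l)))) ^ (2 ^ d)
       \<le> gip d W (\<lambda>_ l. g (u # l) * g (u' # l))"
    proof (rule Suc.IH)
      fix i :: nat and l assume "i < d"
      then show "\<bar>B (Suc i) (u # l) * B (Suc i) (u' # l)\<bar> \<le> 1"
        using Suc.prems(1)[of "Suc i"] by (simp add: abs_mult mult_le_one)
      show "B (Suc i) (u # l[i := x]) * B (Suc i) (u' # l[i := x])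
         = B (Suc i) (u # l) * B (Suc i) (u' # l)" for x
        using Suc.prems(2)[of "Suc i" "u # l" x] Suc.prems(2)[of "Suc i" "u' # l" x] \<open>i < d\<close> by simp
    qed
    then show "(lavg d W (\<lambda>l. r u l * r u' l)) ^ (2 ^ d) \<le> gip d W (\<lambda>_ l. g (u # l) * g (u' # l))"
      by (simp add: r_def prod.distrib mult_ac)
  qed
  also have "\<dots> = gip (Suc d) W (\<lambda>_. g)" by (simp add: gip_Suc)
  finally show ?case .
qed

subsection \<open>Functions with few boxes\<close>

text \<open>The functionals below are tested on functions because the array is random:
  \<open>\<Lambda>\<close> averages over a random \<open>g\<close>, in \<open>decouple\<close> the
  indicator of one value at the moved index set.\<close>

definition unit_fun :: "('a list \<Rightarrow> real) set" where
  "unit_fun = {g. \<forall>l. 0 \<le> g l \<and> g l \<le> 1}"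

lemma cube_avg_bounds:
  assumes "finite W" "W \<noteq> {}" "g \<in> unit_fun"
  shows "0 \<le> avg W (\<lambda>u. \<Prod>e\<in>cube d. if e \<in> F then g (u # sel e vs) else 1)"
    "avg W (\<lambda>u. \<Prod>e\<in>cube d. if e \<in> F then g (u # sel e vs) else 1) \<le> 1"
  using assms
  by (auto simp: unit_fun_def intro!: prod_nonneg prod_le_1 averaging.nonneg[OF averaging_avg]
      averaging.upper[OF averaging_avg])

text \<open>If the box count of a \<open>[0,1]\<close>-valued function is close to its minimum \<open>p ^ 2 ^ d\<close>, then so are the counts
  of all subconfigurations of the box. In the induction one coordinate is either frozen, \<open>g (u # _)\<close>, or doubled,
  \<open>g (u # _) * g (u' # _)\<close>, which turns \<open>p\<close> into \<open>p\<^sup>2\<close>; the two cases give the first two moments of the averages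
  \<open>U\<close> over this coordinate, hence their concentration. Each step costs a fourth root of the error.\<close>

lemma box_counting:
  fixes \<Lambda> :: "(('a list \<Rightarrow> real) \<Rightarrow> real) \<Rightarrow> real"
  assumes W: "finite W" "W \<noteq> {}"
    and "averaging unit_fun \<Lambda>" "0 \<le> p" "p \<le> 1" "0 \<le> e" "e \<le> 1"
    and "p \<le> \<Lambda> (lavg d W)"
    and "\<Lambda> (\<lambda>g. gip d W (\<lambda>_. g)) \<le> p ^ 2 ^ d + e"
  shows "\<bar>\<Lambda> (\<lambda>g. gip d W (\<lambda>e l. if e \<in> F then g l else 1)) - (\<Prod>e\<in>cube d. if e \<in> F then p else 1)\<bar>
     \<le> 12 * e powr (1 / 4 ^ d)"
  using assms(3-)
proof (induction d arbitrary: \<Lambda> p e F)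
  case 0
  interpret averaging unit_fun \<Lambda> by fact
  show ?case
  proof (cases "[] \<in> F")
    case True
    then show ?thesis using 0 by (simp add: abs_le_iff)
  next
    case False
    then show ?thesis using 0 by (simp add: const)
  qed
next
  case (Suc d)
  interpret averaging unit_fun \<Lambda> by fact
  note [simp del] = lavg.simps(2)
  interpret A: averaging W "avg W" by (rule averaging_avg[OF W])
  define Fb where "Fb b = {e. b # e \<in> F}" for b
  define U where "U F' g vs = avg W (\<lambda>u. \<Prod>e\<in>cube d. if e \<in> F' then g (u # sel e vs) else (1::real))"
    for F' and g :: "'a list \<Rightarrow> real" and vs
  define c where "c F' = (\<Prod>e\<in>cube d. if e \<in> F' then p else 1)" for F'
  define \<Lambda>1 where "\<Lambda>1 = (\<lambda>h. \<Lambda> (\<lambda>g. avg W (\<lambda>u. h (\<lambda>l. g (u # l)))))"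
  define \<Lambda>2 where "\<Lambda>2 = (\<lambda>h. \<Lambda> (\<lambda>g. avg W (\<lambda>u. avg W (\<lambda>u'. h (\<lambda>l. g (u # l) * g (u' # l))))))"
  \<comment> \<open>The joint law of the random function and the \<open>d\<close> remaining pairs,
    under which \<open>U\<close> is a random variable.\<close>
  define M where "M = (\<lambda>h. \<Lambda> (\<lambda>g. lavg d (W \<times> W) (\<lambda>vs. h (g, vs))))"
  have WW: "finite (W \<times> W)" "W \<times> W \<noteq> {}" using W by auto
  interpret M: averaging "unit_fun \<times> nlists d (W \<times> W)" M
    unfolding M_def by (rule pair[OF averaging_lavg[OF WW]])
  have a1: "averaging unit_fun \<Lambda>1"
    unfolding \<Lambda>1_def by (rule bind, rule A.map) (auto simp: unit_fun_def)
  have a2: "averaging unit_fun \<Lambda>2"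
    unfolding \<Lambda>2_def
    by (rule bind, rule A.bind, rule A.map) (auto simp: unit_fun_def mult_le_one)
  have M1: "M (\<lambda>(g, vs). U F' g vs) = \<Lambda>1 (\<lambda>g. gip d W (\<lambda>e l. if e \<in> F' then g l else 1))" for F'
    unfolding M_def \<Lambda>1_def U_def gip_def by (simp add: avg_lavg_swap)
  have M2: "M (\<lambda>(g, vs). (U F' g vs)\<^sup>2) = \<Lambda>2 (\<lambda>g. gip d W (\<lambda>e l. if e \<in> F' then g l else 1))" for F'
    unfolding M_def \<Lambda>2_def U_def gip_def power2_eq_square
    by (simp add: avg_mult prod.distrib[symmetric] avg_lavg_swap if_distrib cong: if_cong)
  have box: "\<Lambda> (\<lambda>g. gip (Suc d) W (\<lambda>_. g)) = M (\<lambda>(g, vs). (U UNIV g vs)\<^sup>2)"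
    unfolding M_def U_def gip_Suc_square by (simp add: power2_eq_square)
  have pp: "p ^ 2 ^ Suc d = (p\<^sup>2) ^ 2 ^ d" "p ^ 2 ^ Suc d = (p ^ 2 ^ d)\<^sup>2"
    by (simp_all add: power_mult[symmetric] mult.commute)
  have h1: "p \<le> \<Lambda>1 (lavg d W)"
    using Suc.prems(6) by (simp add: \<Lambda>1_def lavg.simps(2))
  \<comment> \<open>Cauchy--Schwarz over the common tail: doubling the head at least squares the
    lower bound on the mean.\<close>
  have h2: "p\<^sup>2 \<le> \<Lambda>2 (lavg d W)"
  proof -
    have av: "averaging (unit_fun \<times> nlists d W) (\<lambda>h. \<Lambda> (\<lambda>g. lavg d W (\<lambda>l. h (g, l))))"
      by (rule pair[OF averaging_lavg[OF W]])
    have "p\<^sup>2 \<le> (\<Lambda> (\<lambda>g. lavg d W (\<lambda>l. avg W (\<lambda>u. g (u # l)))))\<^sup>2"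
      using Suc.prems(2,6) by (intro power_mono) (simp_all add: lavg.simps(2) avg_lavg_swap)
    also have "\<dots> \<le> \<Lambda> (\<lambda>g. lavg d W (\<lambda>l. (avg W (\<lambda>u. g (u # l)))\<^sup>2))"
      using averaging.square_le[OF av, of "\<lambda>(g, l). avg W (\<lambda>u. g (u # l))"] by simp
    also have "\<dots> = \<Lambda>2 (lavg d W)"
      by (simp add: \<Lambda>2_def power2_eq_square avg_mult avg_lavg_swap)
    finally show ?thesis .
  qed
  have b2: "\<Lambda>2 (\<lambda>g. gip d W (\<lambda>_. g)) \<le> (p\<^sup>2) ^ 2 ^ d + e"
    using Suc.prems(7) M2[of UNIV] unfolding box pp(1) by simp
  have b1: "\<Lambda>1 (\<lambda>g. gip d W (\<lambda>_. g)) \<le> p ^ 2 ^ d + sqrt e"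
  proof (rule power2_le_imp_le)
    have "(\<Lambda>1 (\<lambda>g. gip d W (\<lambda>_. g)))\<^sup>2 = (M (\<lambda>(g, vs). U UNIV g vs))\<^sup>2"
      using M1[of UNIV] by simp
    also have "\<dots> \<le> M (\<lambda>(g, vs). (U UNIV g vs)\<^sup>2)"
      using M.square_le[of "\<lambda>(g, vs). U UNIV g vs"] by (simp add: case_prod_unfold)
    also have "\<dots> \<le> (p ^ 2 ^ d)\<^sup>2 + e"
      using Suc.prems(7) unfolding box pp(2) .
    also have "\<dots> \<le> (p ^ 2 ^ d + sqrt e)\<^sup>2"
      using Suc.prems by (simp add: power2_sum)
    finally show "(\<Lambda>1 (\<lambda>g. gip d W (\<lambda>_. g)))\<^sup>2 \<le> (p ^ 2 ^ d + sqrt e)\<^sup>2" .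
  qed (use Suc.prems in simp)
  \<comment> \<open>The constant 12 reproduces itself: the second moment contributes one error and
    the first moment two, in total at most \<open>36 * sqrt e powr (1 / 4 ^ d) = s\<^sup>2\<close>,
    and the product of two concentrated factors then costs
    \<open>2 * s = 12 * e powr (1 / 4 ^ Suc d)\<close>.\<close>
  define s where "s = 6 * e powr (1 / 4 ^ Suc d)"
  have "e \<le> sqrt e"
    using Suc.prems by (simp add: real_le_rsqrt power2_eq_square mult_left_le)
  then have "e powr (1 / 4 ^ d) \<le> sqrt e powr (1 / 4 ^ d)"
    using Suc.prems by (intro powr_mono2) auto
  moreover have "36 * sqrt e powr (1 / 4 ^ d) = s\<^sup>2"
    using Suc.prems
    by (simp add: s_def powr_half_sqrt[symmetric] powr_powr power_mult_distrib power2_eq_square powr_add[symmetric])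
  ultimately have s2: "36 * e powr (1 / 4 ^ d) \<le> s\<^sup>2" "36 * sqrt e powr (1 / 4 ^ d) = s\<^sup>2"
    by auto
  have c01: "0 \<le> c F'" "c F' \<le> 1" for F'
    unfolding c_def using Suc.prems by (auto intro!: prod_nonneg prod_le_1)
  have cc: "(\<Prod>e\<in>cube d. if e \<in> F' then p\<^sup>2 else 1) = (c F')\<^sup>2" for F'
    unfolding c_def prod_power_distrib by (rule prod.cong) auto
  have L1: "M (\<lambda>(g, vs). \<bar>U F' g vs - c F'\<bar>) \<le> s" for F'
  proof -
    have 1: "\<bar>M (\<lambda>(g, vs). U F' g vs) - c F'\<bar> \<le> 12 * sqrt e powr (1 / 4 ^ d)"
      unfolding M1 c_def using Suc.prems by (intro Suc.IH[OF a1 _ _ _ _ h1 b1]) auto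
    have 2: "\<bar>M (\<lambda>(g, vs). (U F' g vs)\<^sup>2) - (c F')\<^sup>2\<bar> \<le> 12 * e powr (1 / 4 ^ d)"
      unfolding M2 cc[symmetric] using Suc.prems
      by (intro Suc.IH[OF a2 _ _ _ _ h2 b2]) (auto intro: power_le_one)
    have 3: "c F' * \<bar>M (\<lambda>(g, vs). U F' g vs) - c F'\<bar> \<le> \<bar>M (\<lambda>(g, vs). U F' g vs) - c F'\<bar>"
      using c01 by (intro mult_left_le_one_le) auto
    have 4: "- (c F' * (M (\<lambda>(g, vs). U F' g vs) - c F')) \<le> c F' * \<bar>M (\<lambda>(g, vs). U F' g vs) - c F'\<bar>"
      unfolding mult_minus_right[symmetric] using c01 by (intro mult_left_mono) auto
    have "M (\<lambda>x. ((case x of (g, vs) \<Rightarrow> U F' g vs) - c F')\<^sup>2)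
       = M (\<lambda>(g, vs). (U F' g vs)\<^sup>2) - (c F')\<^sup>2 - 2 * (c F' * (M (\<lambda>(g, vs). U F' g vs) - c F'))"
      unfolding M.second_moment by (simp add: case_prod_unfold algebra_simps power2_eq_square)
    also have "\<dots> \<le> s\<^sup>2"
      using 1 2 3 4 s2 by linarith
    finally show ?thesis
      using M.L1_le[of "\<lambda>(g, vs). U F' g vs" "c F'" s] by (simp add: s_def case_prod_unfold)
  qed
  have "\<Lambda> (\<lambda>g. gip (Suc d) W (\<lambda>e l. if e \<in> F then g l else 1))
      = M (\<lambda>(g, vs). U (Fb False) g vs * U (Fb True) g vs)"
    unfolding M_def gip_Suc_square U_def Fb_def by simp
  moreover have "(\<Prod>e\<in>cube (Suc d). if e \<in> F then p else 1) = c (Fb False) * c (Fb True)"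
    unfolding prod_cube_Suc c_def Fb_def prod.distrib by simp
  moreover have "\<bar>M (\<lambda>(g, vs). U (Fb False) g vs * U (Fb True) g vs) - c (Fb False) * c (Fb True)\<bar> \<le> 2 * s"
  proof -
    have "\<bar>M (\<lambda>(g, vs). U (Fb False) g vs * U (Fb True) g vs) - c (Fb False) * c (Fb True)\<bar>
       = \<bar>M (\<lambda>x. (case x of (g, vs) \<Rightarrow> U (Fb False) g vs * U (Fb True) g vs) - c (Fb False) * c (Fb True))\<bar>"
      by (simp add: M.diff M.const)
    also have "\<dots> \<le> M (\<lambda>x. \<bar>(case x of (g, vs) \<Rightarrow> U (Fb False) g vs * U (Fb True) g vs) - c (Fb False) * c (Fb True)\<bar>)"
      by (rule M.abs_le)
    also have "\<dots> \<le> M (\<lambda>x. (case x of (g, vs) \<Rightarrow> \<bar>U (Fb False) g vs - c (Fb False)\<bar>)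
        + (case x of (g, vs) \<Rightarrow> \<bar>U (Fb True) g vs - c (Fb True)\<bar>))"
    proof (rule M.mono)
      fix x :: "('a list \<Rightarrow> real) \<times> ('a \<times> 'a) list"
      assume x: "x \<in> unit_fun \<times> nlists d (W \<times> W)"
      obtain g vs where [simp]: "x = (g, vs)" by force
      define a b where "a = U (Fb False) g vs" and "b = U (Fb True) g vs"
      have ab: "0 \<le> b" "b \<le> 1"
        using x cube_avg_bounds[OF W, where g = g and d = d and vs = vs] by (auto simp: a_def b_def U_def)
      have "a * b - c (Fb False) * c (Fb True) = (a - c (Fb False)) * b + c (Fb False) * (b - c (Fb True))"
        by (simp add: algebra_simps)
      also have "\<bar>\<dots>\<bar> \<le> \<bar>a - c (Fb False)\<bar> * b + c (Fb False) * \<bar>b - c (Fb True)\<bar>"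
        using ab c01 by (intro order_trans[OF abs_triangle_ineq]) (simp add: abs_mult)
      also have "\<dots> \<le> \<bar>a - c (Fb False)\<bar> + \<bar>b - c (Fb True)\<bar>"
        using ab c01 by (intro add_mono mult_right_le_one_le mult_left_le_one_le) auto
      finally show "\<bar>(case x of (g, vs) \<Rightarrow> U (Fb False) g vs * U (Fb True) g vs) - c (Fb False) * c (Fb True)\<bar>
        \<le> (case x of (g, vs) \<Rightarrow> \<bar>U (Fb False) g vs - c (Fb False)\<bar>)
        + (case x of (g, vs) \<Rightarrow> \<bar>U (Fb True) g vs - c (Fb True)\<bar>)"
        by (simp add: a_def b_def)
    qed
    also have "\<dots> \<le> 2 * s"
      using L1[of "Fb False"] L1[of "Fb True"] by (simp add: M.add)
    finally show ?thesis .
  qed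
  ultimately show ?case by (simp add: s_def)
qed

text \<open>Expanding the product over the corners gives \<open>2 ^ 2 ^ d\<close> counts of
  subconfigurations with coefficients of size at most 1. Were each count equal to its predicted
  value, the sum would be the product of \<open>p - p\<close> over the corners, that is 0; only the
  counting errors remain.\<close>

lemma box_norm_small:
  fixes \<Lambda> :: "(('a list \<Rightarrow> real) \<Rightarrow> real) \<Rightarrow> real"
  assumes W: "finite W" "W \<noteq> {}"
    and av: "averaging unit_fun \<Lambda>" and p: "0 \<le> p" "p \<le> 1" and e: "0 \<le> e" "e \<le> 1"
    and mean: "p \<le> \<Lambda> (lavg d W)"
    and box: "\<Lambda> (\<lambda>g. gip d W (\<lambda>_. g)) \<le> p ^ 2 ^ d + e"
  shows "\<Lambda> (\<lambda>g. gip d W (\<lambda>_ l. g l - p)) \<le> 2 ^ 2 ^ d * (12 * e powr (1 / 4 ^ d))"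
proof -
  interpret averaging unit_fun \<Lambda> by fact
  have WW: "finite (W \<times> W)" "W \<times> W \<noteq> {}" using W by auto
  interpret L: averaging "nlists d (W \<times> W)" "lavg d (W \<times> W)" by (rule averaging_lavg[OF WW])
  define r where "r = 12 * e powr (1 / 4 ^ d)"
  define w where "w F = (\<Prod>e\<in>cube d - F. - p)" for F :: "bool list set"
  have expand: "(\<Prod>e\<in>cube d. h e - p) = (\<Sum>F\<in>Pow (cube d). w F * (\<Prod>e\<in>cube d. if e \<in> F then h e else 1))"
    for h :: "bool list \<Rightarrow> real"
  proof -
    have "(\<Prod>e\<in>cube d. h e - p) = (\<Prod>e\<in>cube d. h e + - p)" by simp
    also have "\<dots> = (\<Sum>F\<in>Pow (cube d). prod h F * w F)"
      unfolding w_def by (rule prod_add) simp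
    also have "\<dots> = (\<Sum>F\<in>Pow (cube d). w F * (\<Prod>e\<in>cube d. if e \<in> F then h e else 1))"
      by (rule sum.cong) (auto simp: prod.inter_restrict[symmetric] Int_absorb1)
    finally show ?thesis .
  qed
  have "gip d W (\<lambda>_ l. g l - p) = (\<Sum>F\<in>Pow (cube d). w F * gip d W (\<lambda>e l. if e \<in> F then g l else 1))" for g
    unfolding gip_def expand L.sum L.scale ..
  then have "\<Lambda> (\<lambda>g. gip d W (\<lambda>_ l. g l - p))
      = (\<Sum>F\<in>Pow (cube d). w F * \<Lambda> (\<lambda>g. gip d W (\<lambda>e l. if e \<in> F then g l else 1)))"
    by (simp add: sum scale)
  also have "\<dots> \<le> (\<Sum>F\<in>Pow (cube d). w F * (\<Prod>e\<in>cube d. if e \<in> F then p else 1) + r)"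
  proof (rule sum_mono)
    fix F assume "F \<in> Pow (cube d)"
    have "\<bar>w F\<bar> \<le> 1" unfolding w_def abs_prod using p by (intro prod_le_1) auto
    then have "\<bar>w F\<bar> * \<bar>\<Lambda> (\<lambda>g. gip d W (\<lambda>e l. if e \<in> F then g l else 1))
       - (\<Prod>e\<in>cube d. if e \<in> F then p else 1)\<bar> \<le> 1 * r"
      unfolding r_def
      by (intro mult_mono box_counting[OF W av p e mean box]) auto
    then have "\<bar>w F * \<Lambda> (\<lambda>g. gip d W (\<lambda>e l. if e \<in> F then g l else 1))
       - w F * (\<Prod>e\<in>cube d. if e \<in> F then p else 1)\<bar> \<le> r"
      by (simp add: abs_mult[symmetric] right_diff_distrib)
    then show "w F * \<Lambda> (\<lambda>g. gip d W (\<lambda>e l. if e \<in> F then g l else 1))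
      \<le> w F * (\<Prod>e\<in>cube d. if e \<in> F then p else 1) + r" by linarith
  qed
  also have "\<dots> = (\<Prod>e\<in>cube d. p - p) + 2 ^ 2 ^ d * r"
    unfolding expand sum.distrib by (simp add: card_Pow card_cube)
  also have "(\<Prod>e\<in>cube d. p - p) = 0"
    using card_cube[of d] by (simp add: card_gt_0_iff)
  finally show ?thesis by (simp add: r_def)
qed

subsection \<open>Spreadable arrays\<close>

lemma averaging_pmf:
  assumes "finite (set_pmf P)"
  shows "averaging (set_pmf P) (measure_pmf.expectation P)"
proof -
  have [simp]: "integrable (measure_pmf P) h" for h :: "'a \<Rightarrow> real"
    using assms by (rule integrable_measure_pmf_finite)
  show ?thesis
    by unfold_locales (auto intro!: integral_nonneg_AE simp: AE_measure_pmf_iff)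
qed

lemma expectation_of_bool:
  "measure_pmf.expectation P (\<lambda>\<omega>. of_bool (Q \<omega>)) = measure_pmf.prob P {\<omega>. Q \<omega>}"
proof -
  have "(\<lambda>\<omega>. of_bool (Q \<omega>) :: real) = indicator {\<omega>. Q \<omega>}" by (auto simp: indicator_def)
  then show ?thesis by simp
qed

lemma prod_of_bool: "finite A \<Longrightarrow> (\<Prod>x\<in>A. of_bool (Q x) :: real) = of_bool (\<forall>x\<in>A. Q x)"
  by (induction A rule: finite_induct) auto

lemma enum_set_image:
  assumes "strict_mono_on {1..l} \<phi>" "i \<in> {1..l}"
  shows "enum_set (\<phi> ` {1..l}) i = \<phi> i"
proof -
  have "sorted_wrt (<) (map \<phi> [1..<Suc l])"
    unfolding sorted_wrt_map
    by (rule sorted_wrt_mono_rel[OF _ sorted_wrt_upt]) (use assms(1) in \<open>auto simp: strict_mono_on_def\<close>)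
  moreover have "card (\<phi> ` {1..l}) = l"
    using strict_mono_on_imp_inj_on[OF assms(1)] by (simp add: card_image)
  ultimately have "sorted_list_of_set (\<phi> ` {1..l}) = map \<phi> [1..<Suc l]"
    by (subst sorted_list_of_set_unique[symmetric]) (auto simp: atLeastLessThanSuc_atLeastAtMost simp del: upt_Suc)
  moreover have "map \<phi> [1..<Suc l] ! (i - 1) = \<phi> (1 + (i - 1))"
    by (rule nth_map_upt) (use assms(2) in auto)
  ultimately show ?thesis using assms(2) unfolding enum_set_def by simp
qed

lemma enum_set_enumerates:
  assumes "finite s"
  shows "strict_mono_on {1..card s} (enum_set s)" "enum_set s ` {1..card s} = s"
proof -
  have 1: "sorted_wrt (<) (sorted_list_of_set s)" by simp
  show "strict_mono_on {1..card s} (enum_set s)"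
    unfolding strict_mono_on_def enum_set_def
    by (auto intro!: sorted_wrt_nth_less[OF 1] simp: diff_less_mono)
  have "s = set (sorted_list_of_set s)" using assms by simp
  also have "\<dots> = (\<lambda>i. sorted_list_of_set s ! i) ` {..<card s}"
    by (auto simp: set_conv_nth image_iff)
  also have "{..<card s} = (\<lambda>i. i - 1) ` {1..card s}"
    by (force simp: image_iff Bex_def)
  finally show "enum_set s ` {1..card s} = s"
    by (simp add: image_image enum_set_def[abs_def])
qed

lemma tv_dist_ge: "\<bar>measure_pmf.prob P A - measure_pmf.prob Q A\<bar> \<le> tv_dist P Q"
  unfolding tv_dist_def
proof (rule cSUP_upper)
  have "\<bar>measure_pmf.prob P A - measure_pmf.prob Q A\<bar> \<le> 1" for A
    using measure_pmf.prob_le_1[of P A] measure_pmf.prob_le_1[of Q A]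
      measure_nonneg[of P A] measure_nonneg[of Q A] by linarith
  then show "bdd_above (range (\<lambda>A. \<bar>measure_pmf.prob P A - measure_pmf.prob Q A\<bar>))"
    by (intro bdd_aboveI[of _ 1]) auto
qed simp

text \<open>An increasing map enumerates its own image, so the subarray on the image of
  \<open>\<phi>\<close> reads the array through \<open>\<phi>\<close>. The form with maps instead of
  sets suits the later use, where vertices are moved inside windows.\<close>

lemma spreadable_event:
  assumes sp: "spreadable \<eta> n d P" and "d \<le> l" and F: "F \<subseteq> nsubsets {1..l} d"
    and \<phi>: "strict_mono_on {1..l} \<phi>" "\<phi> ` {1..l} \<subseteq> {1..n}"
    and \<psi>: "strict_mono_on {1..l} \<psi>" "\<psi> ` {1..l} \<subseteq> {1..n}"
  shows "\<bar>measure_pmf.prob P {\<omega>. \<forall>s\<in>F. \<omega> (\<phi> ` s) = a s}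
        - measure_pmf.prob P {\<omega>. \<forall>s\<in>F. \<omega> (\<psi> ` s) = a s}\<bar> \<le> \<eta>"
proof -
  define A where "A = {x. \<forall>s\<in>F. x s = a s}"
  have card: "card (\<theta> ` {1..l}) = l" if "strict_mono_on {1..l} \<theta>" for \<theta> :: "nat \<Rightarrow> nat"
    using strict_mono_on_imp_inj_on[OF that] by (simp add: card_image)
  have sub: "subarray (\<theta> ` {1..l}) d -` A = {\<omega>. \<forall>s\<in>F. \<omega> (\<theta> ` s) = a s}"
    if \<theta>: "strict_mono_on {1..l} \<theta>" for \<theta>
  proof -
    have "subarray (\<theta> ` {1..l}) d \<omega> s = \<omega> (\<theta> ` s)" if "s \<in> F" for \<omega> :: "nat set \<Rightarrow> 'a" and s
    proof -
      have "s \<subseteq> {1..l}" using that F by (auto simp: nsubsets_def)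
      then have "enum_set (\<theta> ` {1..l}) ` s = \<theta> ` s"
        by (intro image_cong refl enum_set_image[OF \<theta>]) auto
      then show ?thesis using that F unfolding subarray_def card[OF \<theta>] by auto
    qed
    then show ?thesis by (auto simp: A_def)
  qed
  have "\<bar>measure_pmf.prob (map_pmf (subarray (\<phi> ` {1..l}) d) P) A
        - measure_pmf.prob (map_pmf (subarray (\<psi> ` {1..l}) d) P) A\<bar> \<le> \<eta>"
    using sp \<phi> \<psi> \<open>d \<le> l\<close> card unfolding spreadable_def
    by (intro order_trans[OF tv_dist_ge]) auto
  then show ?thesis unfolding measure_map_pmf sub[OF \<phi>(1)] sub[OF \<psi>(1)] .
qed

lemma spreadable_marginal:
  assumes sp: "spreadable \<eta> n d P" and s: "s \<in> nsubsets {1..n} d" "s' \<in> nsubsets {1..n} d"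
  shows "\<bar>measure_pmf.prob P {\<omega>. \<omega> s = a} - measure_pmf.prob P {\<omega>. \<omega> s' = a}\<bar> \<le> \<eta>"
proof -
  have fin: "finite s" "finite s'" and card: "card s = d" "card s' = d"
    using s by (auto simp: nsubsets_def finite_subset)
  \<comment> \<open>For \<open>l = d\<close> the only index set is \<open>{1..d}\<close>, and the
    enumeration of \<open>s\<close> sends it to \<open>s\<close>.\<close>
  have "\<bar>measure_pmf.prob P {\<omega>. \<forall>t\<in>{{1..d}}. \<omega> (enum_set s ` t) = a}
      - measure_pmf.prob P {\<omega>. \<forall>t\<in>{{1..d}}. \<omega> (enum_set s' ` t) = a}\<bar> \<le> \<eta>"
    using enum_set_enumerates[OF fin(1)] enum_set_enumerates[OF fin(2)] card s
    by (intro spreadable_event[OF sp order_refl]) (auto simp: nsubsets_def)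
  then show ?thesis
    using enum_set_enumerates(2)[OF fin(1)] enum_set_enumerates(2)[OF fin(2)] card by simp
qed

text \<open>The bit \<open>e ! i\<close> chooses between \<open>2 * i + 1\<close> and
  \<open>2 * i + 2\<close>; list positions count from 0, so this is the pair with index
  \<open>Suc i\<close> in \<open>Box\<close>.\<close>

definition box_vertex :: "nat \<Rightarrow> bool list \<Rightarrow> nat set" where
  "box_vertex d e = (\<lambda>i. 2 * i + 1 + of_bool (e ! i)) ` {..<d}"

lemma box_vertex_inter:
  assumes "i < d"
  shows "box_vertex d e \<inter> {2 * Suc i - 1, 2 * Suc i} = {2 * i + 1 + of_bool (e ! i)}"
proof -
  have "2 * j + 1 + of_bool (e ! j) \<in> {2 * Suc i - 1, 2 * Suc i} \<longleftrightarrow> j = i" for j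
    by (cases "e ! j"; simp; presburger)
  then have "{j. j < d \<and> 2 * j + 1 + of_bool (e ! j) \<in> {2 * Suc i - 1, 2 * Suc i}} = {i}"
    using assms by auto
  moreover have "box_vertex d e \<inter> A = (\<lambda>i. 2 * i + 1 + of_bool (e ! i)) ` {j. j < d \<and> 2 * j + 1 + of_bool (e ! j) \<in> A}"
    for A by (auto simp: box_vertex_def)
  ultimately show ?thesis by simp
qed

lemma box_vertex_inj: "inj_on (box_vertex d) (cube d)"
proof (rule inj_onI)
  fix e e' assume *: "e \<in> cube d" "e' \<in> cube d" "box_vertex d e = box_vertex d e'"
  show "e = e'"
  proof (rule nth_equalityI)
    show "length e = length e'" using * by (simp add: cube_def)
    fix i assume "i < length e"
    then have "i < d" using * by (simp add: cube_def)
    then show "e ! i = e' ! i"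
      using box_vertex_inter[of i d e] box_vertex_inter[of i d e'] * by (auto split: if_splits simp: of_bool_def)
  qed
qed

lemma box_vertex_nsubsets: "box_vertex d e \<in> nsubsets {1..2 * d} d"
proof -
  have "inj_on (\<lambda>i. 2 * i + 1 + of_bool (e ! i) :: nat) {..<d}"
    by (rule inj_onI, rename_tac x y, case_tac "e ! x"; case_tac "e ! y"; simp; presburger)
  then have "card (box_vertex d e) = d" by (simp add: box_vertex_def card_image)
  then show ?thesis by (auto simp: nsubsets_def box_vertex_def of_bool_def)
qed

lemma Box_eq:
  assumes "2 * d \<le> n"
  shows "Box n d = box_vertex d ` cube d"
proof (intro equalityI subsetI)
  fix s assume "s \<in> box_vertex d ` cube d"
  then obtain e where s: "s = box_vertex d e" by auto
  have "card (s \<inter> {2 * i - 1, 2 * i}) = 1" if i: "i \<in> {1..d}" for i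
  proof -
    obtain j where "i = Suc j" "j < d" using i by (cases i) auto
    then show ?thesis using box_vertex_inter[of j d e] by (simp add: s)
  qed
  then show "s \<in> Box n d"
    using box_vertex_nsubsets[of d e] assms by (auto simp: Box_def s nsubsets_def)
next
  fix s assume "s \<in> Box n d"
  then have s: "s \<subseteq> {1..n}" "card s = d" "\<And>i. i \<in> {1..d} \<Longrightarrow> card (s \<inter> {2 * i - 1, 2 * i}) = 1"
    by (auto simp: Box_def nsubsets_def)
  then have fin: "finite s" by (auto intro: finite_subset)
  \<comment> \<open>The bit records whether \<open>s\<close> contains the larger element of the
    pair; the resulting vertex of the box lies in \<open>s\<close> and has as many elements, hence
    equals it.\<close>
  define e where "e = map (\<lambda>i. 2 * Suc i \<in> s) [0..<d]"
  have e: "e \<in> cube d" by (simp add: e_def cube_def)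
  have "2 * i + 1 + of_bool (e ! i) \<in> s" if "i < d" for i
  proof -
    have "card (s \<inter> {2 * Suc i - 1, 2 * Suc i}) = 1" using s(3)[of "Suc i"] that by simp
    then have "s \<inter> {2 * Suc i - 1, 2 * Suc i} \<noteq> {}" by (metis card.empty zero_neq_one)
    then show ?thesis using that by (auto simp: e_def)
  qed
  then have "box_vertex d e \<subseteq> s" by (auto simp: box_vertex_def)
  moreover have "card (box_vertex d e) = card s"
    using box_vertex_nsubsets[of d e] s by (simp add: nsubsets_def)
  ultimately have "box_vertex d e = s" using fin by (simp add: card_subset_eq)
  then show "s \<in> box_vertex d ` cube d" using e by auto
qed

lemma sel_nth:
  assumes "length e = length vs" "i < length vs"
  shows "sel e vs ! i = (if e ! i then snd (vs ! i) else fst (vs ! i))"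
  using assms by (simp add: sel_def)

text \<open>A union bound over the coordinates. It pays for the degenerate boxes counted by
  \<open>gip\<close>, about which the hypothesis on \<open>Box\<close> says nothing.\<close>

lemma lavg_diagonal:
  assumes "finite W" "W \<noteq> {}"
  shows "lavg d (W \<times> W) (\<lambda>vs. of_bool (\<exists>i<d. fst (vs ! i) = snd (vs ! i))) \<le> d / card W"
proof (induction d)
  case 0
  then show ?case by simp
next
  case (Suc d)
  have WW: "finite (W \<times> W)" "W \<times> W \<noteq> {}" using assms by auto
  interpret A: averaging "W \<times> W" "avg (W \<times> W)" by (rule averaging_avg[OF WW])
  interpret L: averaging "nlists d (W \<times> W)" "lavg d (W \<times> W)" by (rule averaging_lavg[OF WW])
  have 1: "avg (W \<times> W) (\<lambda>v. of_bool (fst v = snd v)) = 1 / card W"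
  proof -
    have "avg W (\<lambda>y. of_bool (x = y)) = 1 / card W" if "x \<in> W" for x
      using that assms by (simp add: avg_def of_bool_def)
    then have "avg (W \<times> W) (\<lambda>v. of_bool (fst v = snd v)) = avg W (\<lambda>x. 1 / card W)"
      unfolding avg_Times by (intro averaging.cong[OF averaging_avg[OF assms]]) simp
    then show ?thesis using averaging.const[OF averaging_avg[OF assms]] by simp
  qed
  have "lavg (Suc d) (W \<times> W) (\<lambda>vs. of_bool (\<exists>i<Suc d. fst (vs ! i) = snd (vs ! i)))
      \<le> avg (W \<times> W) (\<lambda>v. lavg d (W \<times> W) (\<lambda>vs. of_bool (fst v = snd v)
          + of_bool (\<exists>i<d. fst (vs ! i) = snd (vs ! i))))"
    unfolding lavg.simps(2)
    by (intro A.mono L.mono) (auto simp: Ex_less_Suc2)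
  also have "\<dots> \<le> 1 / card W + d / card W"
    using Suc by (simp add: L.add L.const A.add A.const 1)
  finally show ?case by (simp add: add_divide_distrib)
qed

lemma nlists_nth: "l \<in> nlists d A \<Longrightarrow> i < d \<Longrightarrow> l ! i \<in> A"
  by (auto simp: nlists_def)

section \<open>Moving vertices inside disjoint windows\<close>

lemma rank_nth:
  fixes s :: "nat set"
  assumes "finite s" "i < card s"
  shows "card {y\<in>s. y < sorted_list_of_set s ! i} = i"
proof -
  define xs where "xs = sorted_list_of_set s"
  have xs: "sorted_wrt (<) xs" "set xs = s" "length xs = card s"
    using assms by (simp_all add: xs_def)
  have less: "xs ! j < xs ! i \<longleftrightarrow> j < i" if "j < card s" for j
  proof
    assume "j < i"
    then show "xs ! j < xs ! i" using xs assms by (intro sorted_wrt_nth_less[OF xs(1)]) auto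
  next
    assume *: "xs ! j < xs ! i"
    show "j < i"
    proof (rule ccontr)
      assume "\<not> j < i"
      then have "i = j \<or> xs ! i < xs ! j" using xs that by (auto intro!: sorted_wrt_nth_less[OF xs(1)])
      then show False using * by auto
    qed
  qed
  have "{y\<in>s. y < xs ! i} = (!) xs ` {..<i}"
  proof (intro equalityI subsetI)
    fix y assume "y \<in> {y\<in>s. y < xs ! i}"
    then obtain j where "j < card s" "y = xs ! j" "xs ! j < xs ! i"
      using xs by (auto simp: set_conv_nth)
    then show "y \<in> (!) xs ` {..<i}" using less by auto
  next
    fix y assume "y \<in> (!) xs ` {..<i}"
    then show "y \<in> {y\<in>s. y < xs ! i}" using less assms xs nth_mem[of _ xs] by auto
  qed
  moreover have "inj_on ((!) xs) {..<i}"
    using assms by (intro inj_on_nth) (auto simp: xs_def)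
  ultimately show ?thesis by (simp add: card_image xs_def)
qed

text \<open>Every vertex of \<open>{1..l}\<close> is moved to the end of its window of length \<open>M\<close>, except that the vertices
  of \<open>s\<close> are placed in their windows according to the list \<open>u\<close>.\<close>

definition blowup :: "nat \<Rightarrow> nat set \<Rightarrow> nat list \<Rightarrow> nat \<Rightarrow> nat" where
  "blowup M s u x = (if x \<in> s then M * (x - 1) + u ! card {y\<in>s. y < x} else M * x)"

lemma rank_less:
  fixes s :: "nat set"
  assumes "finite s" "x \<in> s"
  shows "card {y\<in>s. y < x} < card s"
  using assms by (intro psubset_card_mono) auto

text \<open>Whatever \<open>u\<close> is, a vertex stays in its own window. As the windows are
  disjoint and ordered, the map is increasing, which is what spreadability needs.\<close>

lemma blowup_bounds:
  assumes "finite s" "card s = d" "u \<in> nlists d {1..M}" "1 \<le> M" "1 \<le> x"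
  shows "M * (x - 1) < blowup M s u x" "blowup M s u x \<le> M * x"
proof -
  have "u ! card {y\<in>s. y < x} \<in> {1..M}" if "x \<in> s"
    using nlists_nth[OF assms(3)] rank_less[OF assms(1) that] assms(2) by simp
  moreover have "M * x = M * (x - 1) + M"
    using assms(5) by (cases x) auto
  ultimately show "M * (x - 1) < blowup M s u x" "blowup M s u x \<le> M * x"
    using assms(4) by (auto simp: blowup_def)
qed

lemma blowup_mono:
  assumes "finite s" "card s = d" "u \<in> nlists d {1..M}" "1 \<le> M"
  shows "strict_mono_on {1..l} (blowup M s u)"
proof (rule strict_mono_onI)
  fix x y assume xy: "x \<in> {1..l}" "y \<in> {1..l}" "x < y"
  have "blowup M s u x \<le> M * x" using assms xy by (intro blowup_bounds) auto
  also have "\<dots> \<le> M * (y - 1)" using xy by auto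
  also have "\<dots> < blowup M s u y" using assms xy by (intro blowup_bounds) auto
  finally show "blowup M s u x < blowup M s u y" .
qed

lemma blowup_image:
  assumes "finite s" "card s = d" "u \<in> nlists d {1..M}" "1 \<le> M" "M * l \<le> n"
  shows "blowup M s u ` {1..l} \<subseteq> {1..n}"
proof
  fix z assume "z \<in> blowup M s u ` {1..l}"
  then obtain x where x: "x \<in> {1..l}" "z = blowup M s u x" by auto
  have "M * x \<le> M * l" using x by auto
  then have "M * x \<le> n" using assms(5) by linarith
  then show "z \<in> {1..n}" using blowup_bounds[OF assms(1-4), of x] x by auto
qed

lemma blowup_self:
  assumes "finite s" "card s = d"
  shows "blowup M s u ` s = (\<lambda>i. M * (sorted_list_of_set s ! i - 1) + u ! i) ` {..<d}"
proof -
  have s: "s = (!) (sorted_list_of_set s) ` {..<d}"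
    using assms set_conv_nth[of "sorted_list_of_set s"] by auto
  have "blowup M s u (sorted_list_of_set s ! i) = M * (sorted_list_of_set s ! i - 1) + u ! i" if "i < d" for i
    using rank_nth[OF assms(1), of i] that s assms by (auto simp: blowup_def)
  then have "blowup M s u ` (!) (sorted_list_of_set s) ` {..<d}
      = (\<lambda>i. M * (sorted_list_of_set s ! i - 1) + u ! i) ` {..<d}"
    by (simp add: image_image)
  then show ?thesis using s by simp
qed

text \<open>The \<open>2 * d\<close> endpoints of nondegenerate pairs, once sorted, are the image of
  \<open>{1..2 * d}\<close> under an increasing map that carries the vertices of \<open>Box\<close>
  to blown-up copies of \<open>s\<close>; spreadability then compares them with the standard
  box.\<close>

lemma blowup_box_prob:
  assumes sp: "spreadable \<eta> n d P" and s: "s \<subseteq> {1..l}" "card s = d" and "1 \<le> M" "M * l \<le> n" "2 * d \<le> n"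
    and vs: "vs \<in> nlists d ({1..M} \<times> {1..M})" "\<And>i. i < d \<Longrightarrow> fst (vs ! i) \<noteq> snd (vs ! i)"
  shows "measure_pmf.prob P {\<omega>. \<forall>e\<in>cube d. \<omega> (blowup M s (sel e vs) ` s) = a}
     \<le> measure_pmf.prob P {\<omega>. \<forall>t\<in>Box n d. \<omega> t = a} + \<eta>"
proof -
  define x where "x i = sorted_list_of_set s ! i" for i
  have fin: "finite s" using s by (auto intro: finite_subset)
  have xs: "x i \<in> {1..l}" if "i < d" for i
  proof -
    have "x i \<in> set (sorted_list_of_set s)" unfolding x_def using that s fin by (intro nth_mem) simp
    then show ?thesis using s fin by auto
  qed
  have x_less: "x i < x j" if "i < j" "j < d" for i j
    using sorted_wrt_nth_less[of "(<)" "sorted_list_of_set s" i j] that s by (simp add: x_def)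
  have len: "length vs = d" and rng: "fst (vs ! i) \<in> {1..M}" "snd (vs ! i) \<in> {1..M}" if "i < d" for i
    using vs(1) nlists_nth[OF vs(1), of i] that by (auto simp: nlists_def mem_Times_iff)
  \<comment> \<open>A pair may be listed in decreasing order, so odd arguments of
    \<open>\<theta>\<close> receive the minimum and even ones the maximum.\<close>
  define m where "m b i = (if b then max (fst (vs ! i)) (snd (vs ! i)) else min (fst (vs ! i)) (snd (vs ! i)))" for b i
  define \<theta> where "\<theta> j = M * (x ((j - 1) div 2) - 1) + m (even j) ((j - 1) div 2)" for j
  have m: "m b i \<in> {1..M}" if "i < d" for b i
    using rng[OF that] by (auto simp: m_def max_def min_def)
  have \<theta>_bounds: "M * (x i - 1) < \<theta> j \<and> \<theta> j \<le> M * x i" if "i = (j - 1) div 2" "j \<in> {1..2 * d}" for i j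
  proof -
    have "i < d" using that by auto
    then have "M * x i = M * (x i - 1) + M" using xs[of i] by (cases "x i") auto
    then show ?thesis using m[OF \<open>i < d\<close>, of "even j"] that by (auto simp: \<theta>_def)
  qed
  have \<theta>: "strict_mono_on {1..2 * d} \<theta>"
  proof (rule strict_mono_onI)
    fix j j' assume j: "j \<in> {1..2 * d}" "j' \<in> {1..2 * d}" "j < j'"
    define i i' where "i = (j - 1) div 2" and "i' = (j' - 1) div 2"
    have i: "i \<le> i'" "i' < d" using j unfolding i_def i'_def by (auto intro: div_le_mono)
    show "\<theta> j < \<theta> j'"
    proof (cases "i = i'")
      case True
      obtain a b where ab: "j = Suc a" "j' = Suc b" using j by (cases j; cases j') auto
      then have "a div 2 = b div 2" "a < b" using True j by (auto simp: i_def i'_def)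
      then have "a = 2 * (a div 2)" "b = 2 * (a div 2) + 1" by presburger+
      then have "j = 2 * i + 1" "j' = 2 * i + 2" using ab by (auto simp: i_def)
      then show ?thesis using vs(2)[of i] i True by (auto simp: \<theta>_def m_def max_def min_def)
    next
      case False
      then have "x i < x i'" using i by (intro x_less) auto
      then have "M * x i \<le> M * (x i' - 1)" by auto
      then show ?thesis using \<theta>_bounds[OF i_def j(1)] \<theta>_bounds[OF i'_def j(2)] by linarith
    qed
  qed
  have \<theta>n: "\<theta> ` {1..2 * d} \<subseteq> {1..n}"
  proof
    fix z assume "z \<in> \<theta> ` {1..2 * d}"
    then obtain j where j: "j \<in> {1..2 * d}" "z = \<theta> j" by auto
    define i where "i = (j - 1) div 2"
    have "i < d" using j by (auto simp: i_def)
    then have "M * x i \<le> M * l" using xs by auto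
    then have "M * x i \<le> n" using \<open>M * l \<le> n\<close> by linarith
    then show "z \<in> {1..n}" using \<theta>_bounds[OF i_def j(1)] j(2) by auto
  qed
  have key: "\<exists>e\<in>cube d. blowup M s (sel e vs) ` s = \<theta> ` box_vertex d e'" if e': "e' \<in> cube d" for e'
  proof
    \<comment> \<open>The bit is flipped where the pair is listed in decreasing order, since
      \<open>sel\<close> chooses by position and \<open>\<theta>\<close> by size.\<close>
    define e where "e = map (\<lambda>i. (e' ! i) \<noteq> (snd (vs ! i) < fst (vs ! i))) [0..<d]"
    show e: "e \<in> cube d" by (simp add: e_def cube_def)
    have "\<theta> (2 * i + 1 + of_bool (e' ! i)) = M * (x i - 1) + sel e vs ! i" if "i < d" for i
      using that e len[OF that] unfolding \<theta>_def
      by (subst sel_nth) (auto simp: cube_def e_def m_def max_def min_def)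
    then show "blowup M s (sel e vs) ` s = \<theta> ` box_vertex d e'"
      unfolding blowup_self[OF fin s(2)] box_vertex_def image_image x_def[symmetric] by (intro image_cong) auto
  qed
  have "measure_pmf.prob P {\<omega>. \<forall>e\<in>cube d. \<omega> (blowup M s (sel e vs) ` s) = a}
     \<le> measure_pmf.prob P {\<omega>. \<forall>t\<in>box_vertex d ` cube d. \<omega> (\<theta> ` t) = a}"
    using key by (intro measure_pmf.finite_measure_mono) (fastforce, simp)
  also have "\<bar>\<dots> - measure_pmf.prob P {\<omega>. \<forall>t\<in>box_vertex d ` cube d. \<omega> (id ` t) = a}\<bar> \<le> \<eta>"
    using assms(6) \<theta> \<theta>n box_vertex_nsubsets
    by (intro spreadable_event[OF sp, of "2 * d"]) (auto simp: strict_mono_on_def)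
  then have "measure_pmf.prob P {\<omega>. \<forall>t\<in>box_vertex d ` cube d. \<omega> (\<theta> ` t) = a}
      \<le> measure_pmf.prob P {\<omega>. \<forall>t\<in>Box n d. \<omega> t = a} + \<eta>"
    unfolding Box_eq[OF assms(6)] by simp
  finally show ?thesis .
qed

lemma prod_diff_le:
  fixes q :: "'s \<Rightarrow> real" and \<eta> :: real
  assumes "\<And>s. s \<in> A \<Longrightarrow> 0 \<le> q s \<and> q s \<le> 1" "0 \<le> p" "p \<le> 1" "\<And>s. s \<in> A \<Longrightarrow> \<bar>q s - p\<bar> \<le> \<eta>"
  shows "\<bar>(\<Prod>s\<in>A. q s) - p ^ card A\<bar> \<le> card A * \<eta>"
proof -
  have "norm ((\<Prod>s\<in>A. q s) - (\<Prod>s\<in>A. p)) \<le> (\<Sum>s\<in>A. norm (q s - p))"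
    using assms by (intro norm_prod_diff) auto
  also have "\<dots> \<le> card A * \<eta>" using assms by (intro sum_bounded_above) auto
  finally show ?thesis by simp
qed

text \<open>The vertices of \<open>s0\<close> are averaged over their windows, which spreadability permits. Every other index set
  in \<open>F\<close> misses a vertex of \<open>s0\<close>, so its indicator does not depend on one of the \<open>d\<close> coordinates and is removed
  by the Gowers--Cauchy--Schwarz inequality, leaving the box norm of the centred indicator at \<open>s0\<close>.\<close>

lemma decouple:
  fixes P :: "(nat set \<Rightarrow> 'a) pmf"
  defines "pr \<equiv> \<lambda>Q. measure_pmf.prob P {\<omega>. Q \<omega>}"
  assumes sp: "spreadable \<eta> n d P" and fin: "finite (set_pmf P)"
    and dims: "1 \<le> d" "d \<le> l" "1 \<le> M" "M * l \<le> n" "2 * d \<le> n"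
    and F: "F \<subseteq> nsubsets {1..l} d" "s0 \<in> F"
    and box: "pr (\<lambda>\<omega>. \<forall>s\<in>Box n d. \<omega> s = a s0) \<le> (\<Prod>s\<in>Box n d. pr (\<lambda>\<omega>. \<omega> s = a s0)) + \<eta>"
    and e: "e = (2 ^ d + 2) * \<eta> + d / M" "e \<le> 1"
  shows "\<bar>pr (\<lambda>\<omega>. \<forall>s\<in>F. \<omega> s = a s) - pr (\<lambda>\<omega>. \<omega> s0 = a s0) * pr (\<lambda>\<omega>. \<forall>s\<in>F - {s0}. \<omega> s = a s)\<bar>
    \<le> (2 ^ 2 ^ d * (12 * e powr (1 / 4 ^ d))) powr (1 / 2 ^ d) + 3 * \<eta>"
proof -
  define W where "W = {1..M}"
  have W: "finite W" "W \<noteq> {}" "card W = M" using dims by (auto simp: W_def)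
  have WW: "finite (W \<times> W)" "W \<times> W \<noteq> {}" using W by auto
  interpret E: averaging "set_pmf P" "measure_pmf.expectation P" by (rule averaging_pmf[OF fin])
  interpret L: averaging "nlists d W" "lavg d W" by (rule averaging_lavg[OF W(1,2)])
  interpret LL: averaging "nlists d (W \<times> W)" "lavg d (W \<times> W)" by (rule averaging_lavg[OF WW])
  have swapE: "measure_pmf.expectation P (\<lambda>\<omega>. lavg k A (h \<omega>)) = lavg k A (\<lambda>l. measure_pmf.expectation P (\<lambda>\<omega>. h \<omega> l))"
    for k and A :: "'x set" and h
  proof (induction k arbitrary: h)
    case (Suc k)
    have "measure_pmf.expectation P (\<lambda>\<omega>. avg A (h' \<omega>)) = avg A (\<lambda>u. measure_pmf.expectation P (\<lambda>\<omega>. h' \<omega> u))" for h'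
      using E.scale[of "1 / card A" "\<lambda>\<omega>. \<Sum>u\<in>A. h' \<omega> u"] by (simp add: avg_def E.sum)
    then show ?case by (simp add: Suc)
  qed simp
  have pr01: "0 \<le> pr Q" "pr Q \<le> 1" for Q by (simp_all add: pr_def)
  have s0: "s0 \<subseteq> {1..l}" "card s0 = d" "finite s0"
    using F by (auto simp: nsubsets_def intro: finite_subset)
  have "finite F" using F(1) by (rule finite_subset) (auto simp: nsubsets_def)
  define b where "b = blowup M s0"
  have b: "strict_mono_on {1..l} (b u)" "b u ` {1..l} \<subseteq> {1..n}" if "u \<in> nlists d W" for u
    using that s0 dims unfolding b_def W_def by (intro blowup_mono[of s0 d] blowup_image[of s0 d]; simp)+
  have "l \<le> M * l" using dims by simp
  then have "l \<le> n" using dims by linarith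
  have idl: "strict_mono_on {1..l} (id :: nat \<Rightarrow> nat)" "id ` {1..l} \<subseteq> {1..n}"
    using \<open>l \<le> n\<close> by (auto simp: strict_mono_on_def)
  have event: "\<bar>pr (\<lambda>\<omega>. \<forall>s\<in>F'. \<omega> (b u ` s) = a' s) - pr (\<lambda>\<omega>. \<forall>s\<in>F'. \<omega> s = a' s)\<bar> \<le> \<eta>"
    if "u \<in> nlists d W" "F' \<subseteq> nsubsets {1..l} d" for u F' a'
    using spreadable_event[OF sp dims(2) that(2) b[OF that(1)] idl, of a'] by (simp add: pr_def)
  have bs0: "b u ` s0 \<in> nsubsets {1..n} d" if "u \<in> nlists d W" for u
  proof -
    have "inj_on (b u) s0"
      using strict_mono_on_imp_inj_on[OF b(1)[OF that]] s0(1) by (rule inj_on_subset)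
    then have "card (b u ` s0) = d" using s0 by (simp add: card_image)
    then show ?thesis using b(2)[OF that] s0(1) by (auto simp: nsubsets_def)
  qed
  \<comment> \<open>Averaging over the moved positions makes the mean hypothesis of
    \<open>box_norm_small\<close> an equality; spreadability keeps \<open>p\<close> within
    \<open>\<eta>\<close> of every marginal.\<close>
  define p where "p = lavg d W (\<lambda>u. pr (\<lambda>\<omega>. \<omega> (b u ` s0) = a s0))"
  have p01: "0 \<le> p" "p \<le> 1"
    unfolding p_def by (rule L.lower, rule pr01) (rule L.upper, rule pr01)
  have p_close: "\<bar>pr (\<lambda>\<omega>. \<omega> s = a s0) - p\<bar> \<le> \<eta>" if "s \<in> nsubsets {1..n} d" for s
  proof -
    have "\<bar>pr (\<lambda>\<omega>. \<omega> s = a s0) - pr (\<lambda>\<omega>. \<omega> (b u ` s0) = a s0)\<bar> \<le> \<eta>" if "u \<in> nlists d W" for u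
      unfolding pr_def by (intro spreadable_marginal[OF sp] bs0 that \<open>s \<in> nsubsets {1..n} d\<close>)
    then have "p \<le> pr (\<lambda>\<omega>. \<omega> s = a s0) + \<eta>" "pr (\<lambda>\<omega>. \<omega> s = a s0) - \<eta> \<le> p"
      unfolding p_def by (intro L.upper L.lower; force simp: abs_le_iff)+
    then show ?thesis by linarith
  qed
  have "\<eta> \<ge> 0" using p_close[OF bs0, of "replicate d 1"] dims by (force simp: nlists_def W_def)
  then have "0 \<le> e" by (simp add: e)
  define f where "f \<omega> u = (of_bool (\<omega> (b u ` s0) = a s0) :: real)" for \<omega> u
  define rest where "rest \<omega> u = (of_bool (\<forall>s\<in>F - {s0}. \<omega> (b u ` s) = a s) :: real)" for \<omega> u
  define Z where "Z \<omega> = lavg d W (\<lambda>u. (f \<omega> u - p) * rest \<omega> u)" for \<omega>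
  have Z_gip: "Z \<omega> ^ 2 ^ d \<le> gip d W (\<lambda>_ u. f \<omega> u - p)" for \<omega>
  proof -
    \<comment> \<open>Another index set of the same size \<open>d\<close> omits a vertex of
      \<open>s0\<close>; the rank of the least omitted one is a coordinate of \<open>u\<close> that
      \<open>s\<close> does not see. The indicators are grouped by this coordinate into the factors
      \<open>B i\<close>.\<close>
    define miss where "miss s = card {y\<in>s0. y < Min (s0 - s)}" for s
    define B where "B i u = (\<Prod>s | s \<in> F - {s0} \<and> miss s = i. of_bool (\<omega> (b u ` s) = a s) :: real)" for i u
    have Min_in: "Min (s0 - s) \<in> s0 - s" if "s \<in> F - {s0}" for s
    proof (intro Min_in)
      have "card s = d" "s \<subseteq> {1..l}" using that F by (auto simp: nsubsets_def)
      then have "card s = d" "finite s" by (auto intro: finite_subset)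
      then show "s0 - s \<noteq> {}" using s0 that card_subset_eq[of s s0] by auto
    qed (use s0 in auto)
    have miss_less: "miss s < d" if "s \<in> F - {s0}" for s
      using rank_less[OF s0(3), of "Min (s0 - s)"] Min_in[OF that] s0(2) by (simp add: miss_def)
    have "rest \<omega> u = (\<Prod>i<d. B i u)" for u
    proof -
      have "(\<Prod>i<d. B i u) = (\<Prod>s\<in>F - {s0}. of_bool (\<omega> (b u ` s) = a s))"
        unfolding B_def using \<open>finite F\<close> miss_less by (intro prod.group) auto
      then show ?thesis using \<open>finite F\<close> by (simp add: prod_of_bool rest_def)
    qed
    then have "Z \<omega> = lavg d W (\<lambda>u. (f \<omega> u - p) * (\<Prod>i<d. B i u))"
      by (simp add: Z_def)
    also have "\<dots> ^ 2 ^ d \<le> gip d W (\<lambda>_ u. f \<omega> u - p)"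
    proof (rule gowers_cauchy_schwarz[OF W(1,2)])
      fix i u x
      show "\<bar>B i u\<bar> \<le> 1" unfolding B_def abs_prod by (intro prod_le_1) auto
      have "b (u[i := x]) ` s = b u ` s" if s: "s \<in> F - {s0}" "miss s = i" for s
      proof (intro image_cong refl)
        fix y assume "y \<in> s"
        have "card {z\<in>s0. z < y} \<noteq> i" if "y \<in> s0"
        proof
          assume eq: "card {z\<in>s0. z < y} = i"
          define y' where "y' = Min (s0 - s)"
          have y': "y' \<in> s0" "y' \<notin> s" "card {z\<in>s0. z < y'} = i"
            using Min_in[OF s(1)] s(2) by (auto simp: y'_def miss_def)
          have *: "card {z\<in>s0. z < v} < card {z\<in>s0. z < w}" if "v < w" "v \<in> s0" for v w
            using that s0(3) by (intro psubset_card_mono) auto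
          have "y = y'"
            using *[of y y'] *[of y' y] eq y' \<open>y \<in> s0\<close> by (metis less_irrefl linorder_neqE_nat)
          then show False using y' \<open>y \<in> s\<close> by simp
        qed
        then show "b (u[i := x]) y = b u y" by (auto simp: b_def blowup_def)
      qed
      then show "B i (u[i := x]) = B i u" by (auto simp: B_def intro: prod.cong)
    qed
    finally show ?thesis .
  qed
  define \<Lambda> where "\<Lambda> = (\<lambda>h :: (nat list \<Rightarrow> real) \<Rightarrow> real. measure_pmf.expectation P (\<lambda>\<omega>. h (f \<omega>)))"
  have av: "averaging unit_fun \<Lambda>"
    unfolding \<Lambda>_def by (rule E.map) (auto simp: f_def unit_fun_def)
  have mean: "p \<le> \<Lambda> (lavg d W)"
    by (simp add: \<Lambda>_def swapE p_def f_def expectation_of_bool pr_def)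
  \<comment> \<open>The cost is \<open>2 ^ d * \<eta>\<close> for replacing the marginals by
    \<open>p\<close>, \<open>\<eta>\<close> for the hypothesis on \<open>Box\<close>,
    \<open>\<eta>\<close> for moving the box, and \<open>d / M\<close> for degenerate pairs.\<close>
  have boxp: "\<Lambda> (\<lambda>g. gip d W (\<lambda>_. g)) \<le> p ^ 2 ^ d + e"
  proof -
    have Bsub: "Box n d \<subseteq> nsubsets {1..n} d" by (auto simp: Box_def)
    have "\<bar>(\<Prod>s\<in>Box n d. pr (\<lambda>\<omega>. \<omega> s = a s0)) - p ^ card (Box n d)\<bar> \<le> card (Box n d) * \<eta>"
      by (intro prod_diff_le conjI pr01 p01 p_close) (use Bsub in auto)
    moreover have "card (Box n d) = 2 ^ d"
      unfolding Box_eq[OF dims(5)] card_image[OF box_vertex_inj] by (rule card_cube)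
    ultimately have bp: "pr (\<lambda>\<omega>. \<forall>s\<in>Box n d. \<omega> s = a s0) \<le> p ^ 2 ^ d + 2 ^ d * \<eta> + \<eta>"
      using box by simp
    have "\<Lambda> (\<lambda>g. gip d W (\<lambda>_. g)) = lavg d (W \<times> W) (\<lambda>vs. pr (\<lambda>\<omega>. \<forall>e\<in>cube d. \<omega> (b (sel e vs) ` s0) = a s0))"
      by (simp add: \<Lambda>_def gip_def swapE f_def prod_of_bool expectation_of_bool pr_def)
    also have "\<dots> \<le> lavg d (W \<times> W) (\<lambda>vs. (p ^ 2 ^ d + (2 ^ d + 2) * \<eta>) + of_bool (\<exists>i<d. fst (vs ! i) = snd (vs ! i)))"
    proof (rule LL.mono)
      fix vs assume vs: "vs \<in> nlists d (W \<times> W)"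
      show "pr (\<lambda>\<omega>. \<forall>e\<in>cube d. \<omega> (b (sel e vs) ` s0) = a s0)
        \<le> (p ^ 2 ^ d + (2 ^ d + 2) * \<eta>) + of_bool (\<exists>i<d. fst (vs ! i) = snd (vs ! i))"
      proof (cases "\<exists>i<d. fst (vs ! i) = snd (vs ! i)")
        case True
        have "0 \<le> p ^ 2 ^ d + (2 ^ d + 2) * \<eta>" using p01 \<open>0 \<le> \<eta>\<close> by simp
        then have "1 \<le> p ^ 2 ^ d + (2 ^ d + 2) * \<eta> + of_bool (\<exists>i<d. fst (vs ! i) = snd (vs ! i))"
          using True by simp
        then show ?thesis using pr01(2) order_trans by blast
      next
        case False
        then have "pr (\<lambda>\<omega>. \<forall>e\<in>cube d. \<omega> (b (sel e vs) ` s0) = a s0)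
          \<le> pr (\<lambda>\<omega>. \<forall>s\<in>Box n d. \<omega> s = a s0) + \<eta>"
          unfolding pr_def b_def using vs dims s0
          by (intro blowup_box_prob[OF sp]) (auto simp: W_def)
        then show ?thesis using bp False by (simp add: algebra_simps)
      qed
    qed
    also have "\<dots> \<le> p ^ 2 ^ d + (2 ^ d + 2) * \<eta> + d / M"
      using lavg_diagonal[OF W(1,2), of d] W(3) by (simp only: LL.add LL.const)
    finally show ?thesis by (simp add: e)
  qed
  define R where "R = 2 ^ 2 ^ d * (12 * e powr (1 / 4 ^ d))"
  have "(measure_pmf.expectation P Z) ^ 2 ^ d \<le> measure_pmf.expectation P (\<lambda>\<omega>. Z \<omega> ^ 2 ^ d)"
    by (rule E.power_le)
  also have "\<dots> \<le> measure_pmf.expectation P (\<lambda>\<omega>. gip d W (\<lambda>_ u. f \<omega> u - p))"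
    by (intro E.mono Z_gip)
  also have "\<dots> \<le> R"
    using box_norm_small[OF W(1,2) av p01 \<open>0 \<le> e\<close> e(2) mean boxp] by (simp add: \<Lambda>_def R_def)
  finally have "(measure_pmf.expectation P Z) ^ 2 ^ d \<le> R" .
  \<comment> \<open>As \<open>1 \<le> d\<close>, the exponent is even, so the bound controls the
    absolute value.\<close>
  moreover have "even ((2::nat) ^ d)" using dims by simp
  ultimately have "\<bar>measure_pmf.expectation P Z\<bar> ^ 2 ^ d \<le> R"
    by (simp add: power_even_abs)
  then have "(\<bar>measure_pmf.expectation P Z\<bar> ^ 2 ^ d) powr (1 / 2 ^ d) \<le> R powr (1 / 2 ^ d)"
    by (intro powr_mono2) auto
  moreover have "(\<bar>measure_pmf.expectation P Z\<bar> ^ 2 ^ d) powr (1 / 2 ^ d) = \<bar>measure_pmf.expectation P Z\<bar>"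
    by (cases "measure_pmf.expectation P Z = 0") (simp_all add: powr_realpow[symmetric] powr_powr)
  ultimately have EZ: "\<bar>measure_pmf.expectation P Z\<bar> \<le> R powr (1 / 2 ^ d)" by simp
  define pF where "pF = pr (\<lambda>\<omega>. \<forall>s\<in>F. \<omega> s = a s)"
  define pF' where "pF' = pr (\<lambda>\<omega>. \<forall>s\<in>F - {s0}. \<omega> s = a s)"
  have "measure_pmf.expectation P Z = lavg d W (\<lambda>u. pr (\<lambda>\<omega>. \<forall>s\<in>F. \<omega> (b u ` s) = a s)
      - p * pr (\<lambda>\<omega>. \<forall>s\<in>F - {s0}. \<omega> (b u ` s) = a s))"
  proof -
    have "(f \<omega> u - p) * rest \<omega> u = of_bool (\<forall>s\<in>F. \<omega> (b u ` s) = a s) - p * of_bool (\<forall>s\<in>F - {s0}. \<omega> (b u ` s) = a s)"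
      for \<omega> u using F(2) by (auto simp: f_def rest_def)
    then show ?thesis
      unfolding Z_def swapE by (simp only: E.diff E.scale expectation_of_bool pr_def)
  qed
  \<comment> \<open>Two events are moved back from the windows; exchanging \<open>p\<close> for the
    marginal at \<open>s0\<close> below costs a third \<open>\<eta>\<close>.\<close>
  also have "\<bar>\<dots> - (pF - p * pF')\<bar> \<le> 2 * \<eta>"
  proof -
    have "\<bar>(pr (\<lambda>\<omega>. \<forall>s\<in>F. \<omega> (b u ` s) = a s)
      - p * pr (\<lambda>\<omega>. \<forall>s\<in>F - {s0}. \<omega> (b u ` s) = a s)) - (pF - p * pF')\<bar> \<le> 2 * \<eta>" if u: "u \<in> nlists d W" for u
    proof -
      have 1: "\<bar>pr (\<lambda>\<omega>. \<forall>s\<in>F. \<omega> (b u ` s) = a s) - pF\<bar> \<le> \<eta>"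
        unfolding pF_def by (rule event[OF u F(1)])
      have "\<bar>pr (\<lambda>\<omega>. \<forall>s\<in>F - {s0}. \<omega> (b u ` s) = a s) - pF'\<bar> \<le> \<eta>"
        unfolding pF'_def by (rule event[OF u]) (use F in auto)
      then have "p * \<bar>pr (\<lambda>\<omega>. \<forall>s\<in>F - {s0}. \<omega> (b u ` s) = a s) - pF'\<bar> \<le> 1 * \<eta>"
        using p01 by (intro mult_mono) auto
      then have "\<bar>p * pr (\<lambda>\<omega>. \<forall>s\<in>F - {s0}. \<omega> (b u ` s) = a s) - p * pF'\<bar> \<le> \<eta>"
        using p01 by (simp add: right_diff_distrib[symmetric] abs_mult)
      then show ?thesis using 1 by linarith
    qed
    then have "\<bar>lavg d W (\<lambda>u. (pr (\<lambda>\<omega>. \<forall>s\<in>F. \<omega> (b u ` s) = a s)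
      - p * pr (\<lambda>\<omega>. \<forall>s\<in>F - {s0}. \<omega> (b u ` s) = a s)) - (pF - p * pF'))\<bar> \<le> 2 * \<eta>"
      by (intro order_trans[OF L.abs_le] L.upper)
    then show ?thesis by (subst (asm) L.diff) (simp only: L.const)
  qed
  finally have "\<bar>measure_pmf.expectation P Z - (pF - p * pF')\<bar> \<le> 2 * \<eta>" .
  moreover have "\<bar>pr (\<lambda>\<omega>. \<omega> s0 = a s0) * pF' - p * pF'\<bar> \<le> \<eta>"
  proof -
    have "s0 \<in> nsubsets {1..n} d" using s0 \<open>l \<le> n\<close> by (auto simp: nsubsets_def)
    then have "\<bar>pr (\<lambda>\<omega>. \<omega> s0 = a s0) - p\<bar> * pF' \<le> \<eta> * 1"
      using p_close pr01 \<open>0 \<le> \<eta>\<close> unfolding pF'_def by (intro mult_mono) auto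
    moreover have "\<bar>pr (\<lambda>\<omega>. \<omega> s0 = a s0) * pF' - p * pF'\<bar> = \<bar>pr (\<lambda>\<omega>. \<omega> s0 = a s0) - p\<bar> * pF'"
      using pr01[of "\<lambda>\<omega>. \<forall>s\<in>F - {s0}. \<omega> s = a s"] by (simp add: left_diff_distrib[symmetric] abs_mult pF'_def)
    ultimately show ?thesis by simp
  qed
  ultimately show ?thesis
    using EZ unfolding pF_def[symmetric] pF'_def[symmetric] R_def by linarith
qed

subsection \<open>Approximate independence\<close>

lemma prob_split:
  assumes "finite (set_pmf P)" "finite X" "\<And>\<omega>. \<omega> \<in> set_pmf P \<Longrightarrow> g \<omega> \<in> X"
  shows "measure_pmf.prob P {\<omega>. Q \<omega>} = (\<Sum>c\<in>X. measure_pmf.prob P {\<omega>. Q \<omega> \<and> g \<omega> = c})"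
proof -
  interpret averaging "set_pmf P" "measure_pmf.expectation P" by (rule averaging_pmf) fact
  have "measure_pmf.expectation P (\<lambda>\<omega>. of_bool (Q \<omega>) :: real)
      = measure_pmf.expectation P (\<lambda>\<omega>. \<Sum>c\<in>X. of_bool (Q \<omega> \<and> g \<omega> = c))"
  proof (rule cong)
    fix \<omega> assume "\<omega> \<in> set_pmf P"
    have "(\<Sum>c\<in>X. of_bool (Q \<omega> \<and> g \<omega> = c) :: real) = (\<Sum>c\<in>X. if g \<omega> = c then of_bool (Q \<omega>) else 0)"
      by (rule sum.cong) auto
    then show "of_bool (Q \<omega>) = (\<Sum>c\<in>X. of_bool (Q \<omega> \<and> g \<omega> = c) :: real)"
      using assms(2) assms(3)[OF \<open>\<omega> \<in> set_pmf P\<close>] by simp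
  qed
  then show ?thesis by (simp only: sum expectation_of_bool)
qed

text \<open>The value outside \<open>S\<close> is handled by complementation, at the price of a factor \<open>card A\<close>.\<close>

lemma decouple_all:
  fixes P :: "(nat set \<Rightarrow> 'a) pmf" and A :: "'a set" and \<rho> :: real
  defines "pr \<equiv> \<lambda>Q. measure_pmf.prob P {\<omega>. Q \<omega>}"
  assumes fin: "finite (set_pmf P)" and A: "finite A" "S \<subseteq> A" "card S = card A - 1"
    and inA: "\<And>\<omega> s. \<omega> \<in> set_pmf P \<Longrightarrow> s \<in> U \<Longrightarrow> \<omega> s \<in> A"
    and dec: "\<And>F s0 a. F \<subseteq> U \<Longrightarrow> s0 \<in> F \<Longrightarrow> a s0 \<in> S \<Longrightarrow>
      \<bar>pr (\<lambda>\<omega>. \<forall>s\<in>F. \<omega> s = a s) - pr (\<lambda>\<omega>. \<omega> s0 = a s0) * pr (\<lambda>\<omega>. \<forall>s\<in>F - {s0}. \<omega> s = a s)\<bar> \<le> \<rho>"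
    and F: "F \<subseteq> U" "s0 \<in> F" and a: "a s0 \<in> A" and "0 \<le> \<rho>"
  shows "\<bar>pr (\<lambda>\<omega>. \<forall>s\<in>F. \<omega> s = a s) - pr (\<lambda>\<omega>. \<omega> s0 = a s0) * pr (\<lambda>\<omega>. \<forall>s\<in>F - {s0}. \<omega> s = a s)\<bar>
    \<le> card A * \<rho>"
proof -
  have "card A \<ge> 1" using a A(1) by (simp add: Suc_le_eq card_gt_0_iff) blast
  define q where "q = pr (\<lambda>\<omega>. \<forall>s\<in>F - {s0}. \<omega> s = a s)"
  define D where "D c = pr (\<lambda>\<omega>. (\<forall>s\<in>F - {s0}. \<omega> s = a s) \<and> \<omega> s0 = c) - pr (\<lambda>\<omega>. \<omega> s0 = c) * q" for c
  have D: "D c = pr (\<lambda>\<omega>. \<forall>s\<in>F. \<omega> s = (a(s0 := c)) s)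
       - pr (\<lambda>\<omega>. \<omega> s0 = (a(s0 := c)) s0) * pr (\<lambda>\<omega>. \<forall>s\<in>F - {s0}. \<omega> s = (a(s0 := c)) s)" for c
  proof -
    have "(\<lambda>\<omega>. (\<forall>s\<in>F - {s0}. \<omega> s = a s) \<and> \<omega> s0 = c) = (\<lambda>\<omega>. \<forall>s\<in>F. \<omega> s = (a(s0 := c)) s)"
      using F(2) by (auto simp: fun_eq_iff)
    moreover have "(\<lambda>\<omega>. \<forall>s\<in>F - {s0}. \<omega> s = a s) = (\<lambda>\<omega>. \<forall>s\<in>F - {s0}. \<omega> s = (a(s0 := c)) s)"
      by (auto simp: fun_eq_iff)
    ultimately show ?thesis unfolding D_def q_def by simp
  qed
  have D_S: "\<bar>D c\<bar> \<le> \<rho>" if "c \<in> S" for c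
    unfolding D using F that by (intro dec) auto
  have goal: "pr (\<lambda>\<omega>. \<forall>s\<in>F. \<omega> s = a s) - pr (\<lambda>\<omega>. \<omega> s0 = a s0) * pr (\<lambda>\<omega>. \<forall>s\<in>F - {s0}. \<omega> s = a s) = D (a s0)"
    unfolding D by simp
  have "(\<Sum>c\<in>A. D c) = 0"
  proof -
    have s0: "\<omega> s0 \<in> A" if "\<omega> \<in> set_pmf P" for \<omega> using inA[OF that] F by auto
    have "(\<Sum>c\<in>A. pr (\<lambda>\<omega>. \<omega> s0 = c)) = 1"
      using prob_split[OF fin A(1) s0, where Q = "\<lambda>_. True"] by (simp add: pr_def)
    moreover have "(\<Sum>c\<in>A. pr (\<lambda>\<omega>. (\<forall>s\<in>F - {s0}. \<omega> s = a s) \<and> \<omega> s0 = c)) = q"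
      unfolding q_def pr_def by (rule prob_split[OF fin A(1) s0, symmetric])
    ultimately show ?thesis by (simp add: D_def sum_subtractf sum_distrib_right[symmetric])
  qed
  have "\<bar>D (a s0)\<bar> \<le> card A * \<rho>"
  proof (cases "a s0 \<in> S")
    case True
    have "1 * \<rho> \<le> card A * \<rho>" using \<open>card A \<ge> 1\<close> \<open>0 \<le> \<rho>\<close> by (intro mult_right_mono) auto
    then show ?thesis using D_S[OF True] by simp
  next
    case False
    have "card (insert (a s0) S) = card A"
      using False A finite_subset[OF A(2,1)] \<open>card A \<ge> 1\<close> by simp
    then have "A = insert (a s0) S"
      using A a by (intro card_subset_eq[symmetric]) auto
    then have "D (a s0) = - (\<Sum>c\<in>S. D c)"
      using \<open>(\<Sum>c\<in>A. D c) = 0\<close> False finite_subset[OF A(2,1)] by simp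
    also have "\<bar>\<dots>\<bar> \<le> (\<Sum>c\<in>S. \<bar>D c\<bar>)" by simp
    also have "\<dots> \<le> card S * \<rho>" by (rule sum_bounded_above) (rule D_S)
    also have "\<dots> \<le> card A * \<rho>" using A(3) \<open>0 \<le> \<rho>\<close> by (intro mult_right_mono) auto
    finally show ?thesis .
  qed
  then show ?thesis unfolding goal .
qed

text \<open>Indices are split off one at a time; earlier errors are only multiplied by marginals,
  which are at most 1, so the errors add up.\<close>

lemma approx_independent:
  fixes P :: "('s \<Rightarrow> 'a) pmf" and \<rho> :: real
  defines "pr \<equiv> \<lambda>Q. measure_pmf.prob P {\<omega>. Q \<omega>}"
  assumes dec: "\<And>F s0. F \<subseteq> U \<Longrightarrow> s0 \<in> F \<Longrightarrow>
      \<bar>pr (\<lambda>\<omega>. \<forall>s\<in>F. \<omega> s = a s) - pr (\<lambda>\<omega>. \<omega> s0 = a s0) * pr (\<lambda>\<omega>. \<forall>s\<in>F - {s0}. \<omega> s = a s)\<bar> \<le> \<rho>"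
    and "finite F" "F \<subseteq> U"
  shows "\<bar>pr (\<lambda>\<omega>. \<forall>s\<in>F. \<omega> s = a s) - (\<Prod>s\<in>F. pr (\<lambda>\<omega>. \<omega> s = a s))\<bar> \<le> card F * \<rho>"
  using assms(3,4)
proof (induction F rule: finite_induct)
  case empty
  then show ?case by (simp add: pr_def)
next
  case (insert x F)
  define q where "q = pr (\<lambda>\<omega>. \<omega> x = a x)"
  have q: "0 \<le> q" "q \<le> 1" by (simp_all add: q_def pr_def)
  have "insert x F - {x} = F" using insert by auto
  then have 1: "\<bar>pr (\<lambda>\<omega>. \<forall>s\<in>insert x F. \<omega> s = a s) - q * pr (\<lambda>\<omega>. \<forall>s\<in>F. \<omega> s = a s)\<bar> \<le> \<rho>"
    using dec[of "insert x F" x] insert.prems unfolding q_def by simp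
  have "q * \<bar>pr (\<lambda>\<omega>. \<forall>s\<in>F. \<omega> s = a s) - (\<Prod>s\<in>F. pr (\<lambda>\<omega>. \<omega> s = a s))\<bar> \<le> 1 * (card F * \<rho>)"
    using insert q by (intro mult_mono) auto
  then have "\<bar>q * pr (\<lambda>\<omega>. \<forall>s\<in>F. \<omega> s = a s) - q * (\<Prod>s\<in>F. pr (\<lambda>\<omega>. \<omega> s = a s))\<bar> \<le> card F * \<rho>"
    using q by (simp add: right_diff_distrib[symmetric] abs_mult)
  then show ?case using 1 insert by (simp add: q_def[symmetric] algebra_simps)
qed

text \<open>Both sides are compared with the product of all single marginals, the joint event
  directly and the product of block probabilities block by block; hence the factor 2.\<close>

lemma approx_independent_blocks:
  fixes P :: "('s \<Rightarrow> 'a) pmf" and B :: "nat \<Rightarrow> 's set" and \<rho> :: real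
  defines "pr \<equiv> \<lambda>Q. measure_pmf.prob P {\<omega>. Q \<omega>}"
  assumes ind: "\<And>F a. F \<subseteq> U \<Longrightarrow> (\<And>s. s \<in> F \<Longrightarrow> a s \<in> A) \<Longrightarrow>
      \<bar>pr (\<lambda>\<omega>. \<forall>s\<in>F. \<omega> s = a s) - (\<Prod>s\<in>F. pr (\<lambda>\<omega>. \<omega> s = a s))\<bar> \<le> card F * \<rho>"
    and B: "\<And>j. j < N \<Longrightarrow> B j \<subseteq> U" "\<And>j. j < N \<Longrightarrow> finite (B j)"
      "\<And>i j. i < N \<Longrightarrow> j < N \<Longrightarrow> i \<noteq> j \<Longrightarrow> B i \<inter> B j = {}"
    and y: "\<And>j s. j < N \<Longrightarrow> s \<in> B j \<Longrightarrow> y j s \<in> A"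
  shows "\<bar>pr (\<lambda>\<omega>. \<forall>j<N. \<forall>s\<in>B j. \<omega> s = y j s) - (\<Prod>j<N. pr (\<lambda>\<omega>. \<forall>s\<in>B j. \<omega> s = y j s))\<bar>
    \<le> 2 * (\<Sum>j<N. card (B j)) * \<rho>"
proof -
  \<comment> \<open>Disjointness of the blocks lets their values be glued into one function.\<close>
  define a where "a s = y (THE j. j < N \<and> s \<in> B j) s" for s
  have a: "a s = y j s" if "j < N" "s \<in> B j" for j s
  proof -
    have "(THE j. j < N \<and> s \<in> B j) = j"
      by (rule the_equality) (use that B(3) in blast)+
    then show ?thesis by (simp add: a_def)
  qed
  define V where "V = (\<Union>j<N. B j)"
  have cV: "card V = (\<Sum>j<N. card (B j))"
    unfolding V_def using B by (intro card_UN_disjoint) auto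
  have pV: "(\<Prod>s\<in>V. pr (\<lambda>\<omega>. \<omega> s = a s)) = (\<Prod>j<N. \<Prod>s\<in>B j. pr (\<lambda>\<omega>. \<omega> s = a s))"
    unfolding V_def using B by (intro prod.UNION_disjoint) auto
  have eV: "(\<lambda>\<omega>. \<forall>j<N. \<forall>s\<in>B j. \<omega> s = y j s) = (\<lambda>\<omega>. \<forall>s\<in>V. \<omega> s = a s)"
    using a by (auto simp: V_def fun_eq_iff)
  have eB: "(\<lambda>\<omega>. \<forall>s\<in>B j. \<omega> s = y j s) = (\<lambda>\<omega>. \<forall>s\<in>B j. \<omega> s = a s)" if "j < N" for j
    using a[OF that] by (auto simp: fun_eq_iff)
  have 1: "\<bar>pr (\<lambda>\<omega>. \<forall>s\<in>V. \<omega> s = a s) - (\<Prod>s\<in>V. pr (\<lambda>\<omega>. \<omega> s = a s))\<bar> \<le> card V * \<rho>"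
  proof (rule ind)
    show "V \<subseteq> U" using B by (auto simp: V_def)
    fix s assume "s \<in> V"
    then obtain j where "j < N" "s \<in> B j" by (auto simp: V_def)
    then show "a s \<in> A" using a y by simp
  qed
  have "norm ((\<Prod>j<N. pr (\<lambda>\<omega>. \<forall>s\<in>B j. \<omega> s = a s)) - (\<Prod>j<N. \<Prod>s\<in>B j. pr (\<lambda>\<omega>. \<omega> s = a s)))
     \<le> (\<Sum>j<N. norm (pr (\<lambda>\<omega>. \<forall>s\<in>B j. \<omega> s = a s) - (\<Prod>s\<in>B j. pr (\<lambda>\<omega>. \<omega> s = a s))))"
    by (intro norm_prod_diff) (auto simp: pr_def abs_prod intro!: prod_le_1)
  also have "\<dots> \<le> (\<Sum>j<N. card (B j) * \<rho>)"
  proof (rule sum_mono)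
    fix j assume "j \<in> {..<N}"
    then have "\<And>s. s \<in> B j \<Longrightarrow> a s \<in> A" using a y by simp
    then show "norm (pr (\<lambda>\<omega>. \<forall>s\<in>B j. \<omega> s = a s) - (\<Prod>s\<in>B j. pr (\<lambda>\<omega>. \<omega> s = a s))) \<le> card (B j) * \<rho>"
      using ind[of "B j" a] B(1)[of j] \<open>j \<in> {..<N}\<close> by simp
  qed
  also have "\<dots> = card V * \<rho>" by (simp add: cV sum_distrib_right)
  finally show ?thesis
    using 1 eB unfolding eV pV by (simp add: cV abs_minus_commute)
qed

text \<open>Expanding each factor over its values leaves one joint probability per tuple of values,
  and each tuple costs \<open>\<kappa>\<close> times its weight, which is at most
  \<open>H ^ N\<close>.\<close>

lemma expectation_prod_le:
  fixes Y :: "nat \<Rightarrow> 'b \<Rightarrow> 'c" and h :: "nat \<Rightarrow> 'c \<Rightarrow> real"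
  assumes fin: "finite (set_pmf P)" and R: "\<And>j. j < N \<Longrightarrow> finite (R j)"
    and Y: "\<And>j \<omega>. j < N \<Longrightarrow> \<omega> \<in> set_pmf P \<Longrightarrow> Y j \<omega> \<in> R j"
    and ind: "\<And>y. (\<And>j. j < N \<Longrightarrow> y j \<in> R j) \<Longrightarrow>
      \<bar>measure_pmf.prob P {\<omega>. \<forall>j<N. Y j \<omega> = y j} - (\<Prod>j<N. measure_pmf.prob P {\<omega>. Y j \<omega> = y j})\<bar> \<le> \<kappa>"
    and h: "\<And>j z. j < N \<Longrightarrow> 0 \<le> h j z" "\<And>j z. j < N \<Longrightarrow> z \<in> R j \<Longrightarrow> h j z \<le> H" and "0 \<le> H" "0 \<le> \<kappa>"
  shows "measure_pmf.expectation P (\<lambda>\<omega>. \<Prod>j<N. h j (Y j \<omega>))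
    \<le> (\<Prod>j<N. measure_pmf.expectation P (\<lambda>\<omega>. h j (Y j \<omega>))) + (\<Prod>j<N. real (card (R j))) * (H ^ N * \<kappa>)"
proof -
  interpret averaging "set_pmf P" "measure_pmf.expectation P" by (rule averaging_pmf) fact
  define E where "E = PiE {..<N} R"
  define w where "w y = (\<Prod>j<N. h j (y j))" for y
  have w: "0 \<le> w y" "w y \<le> H ^ N" if "y \<in> E" for y
  proof -
    show "0 \<le> w y" unfolding w_def by (intro prod_nonneg ballI h) auto
    have "w y \<le> (\<Prod>j<N. H)" unfolding w_def using that by (intro prod_mono conjI h) (auto simp: E_def)
    then show "w y \<le> H ^ N" by simp
  qed
  have expand: "h j (Y j \<omega>) = (\<Sum>z\<in>R j. h j z * of_bool (Y j \<omega> = z))" if "j < N" "\<omega> \<in> set_pmf P" for j \<omega>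
  proof -
    have "(\<Sum>z\<in>R j. h j z * of_bool (Y j \<omega> = z)) = (\<Sum>z\<in>R j. if Y j \<omega> = z then h j z else 0)"
      by (rule sum.cong) auto
    then show ?thesis using R[OF that(1)] Y[OF that] by simp
  qed
  have "measure_pmf.expectation P (\<lambda>\<omega>. \<Prod>j<N. h j (Y j \<omega>))
      = measure_pmf.expectation P (\<lambda>\<omega>. \<Sum>y\<in>E. w y * of_bool (\<forall>j<N. Y j \<omega> = y j))"
  proof (rule cong)
    fix \<omega> assume \<omega>: "\<omega> \<in> set_pmf P"
    have "(\<Prod>j<N. h j (Y j \<omega>)) = (\<Prod>j<N. \<Sum>z\<in>R j. h j z * of_bool (Y j \<omega> = z))"
      using \<omega> by (intro prod.cong expand) auto
    also have "\<dots> = (\<Sum>y\<in>E. \<Prod>j<N. h j (y j) * of_bool (Y j \<omega> = y j))"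
      unfolding E_def by (rule prod_sum_PiE) (auto intro: R)
    also have "\<dots> = (\<Sum>y\<in>E. w y * of_bool (\<forall>j<N. Y j \<omega> = y j))"
      by (simp add: prod.distrib w_def prod_of_bool Ball_def)
    finally show "(\<Prod>j<N. h j (Y j \<omega>)) = (\<Sum>y\<in>E. w y * of_bool (\<forall>j<N. Y j \<omega> = y j))" .
  qed
  also have "\<dots> = (\<Sum>y\<in>E. w y * measure_pmf.prob P {\<omega>. \<forall>j<N. Y j \<omega> = y j})"
    by (simp only: sum scale expectation_of_bool)
  also have "\<dots> \<le> (\<Sum>y\<in>E. w y * (\<Prod>j<N. measure_pmf.prob P {\<omega>. Y j \<omega> = y j}) + H ^ N * \<kappa>)"
  proof (rule sum_mono)
    fix y assume y: "y \<in> E"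
    have "\<bar>measure_pmf.prob P {\<omega>. \<forall>j<N. Y j \<omega> = y j} - (\<Prod>j<N. measure_pmf.prob P {\<omega>. Y j \<omega> = y j})\<bar> \<le> \<kappa>"
      using y by (intro ind) (auto simp: E_def)
    then have "w y * (measure_pmf.prob P {\<omega>. \<forall>j<N. Y j \<omega> = y j} - (\<Prod>j<N. measure_pmf.prob P {\<omega>. Y j \<omega> = y j}))
       \<le> H ^ N * \<kappa>"
      using w[OF y] \<open>0 \<le> \<kappa>\<close> \<open>0 \<le> H\<close>
      by (intro order_trans[OF mult_left_mono mult_right_mono, of _ \<kappa>]) auto
    then show "w y * measure_pmf.prob P {\<omega>. \<forall>j<N. Y j \<omega> = y j}
       \<le> w y * (\<Prod>j<N. measure_pmf.prob P {\<omega>. Y j \<omega> = y j}) + H ^ N * \<kappa>"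
      by (simp add: right_diff_distrib)
  qed
  also have "\<dots> = (\<Sum>y\<in>E. \<Prod>j<N. h j (y j) * measure_pmf.prob P {\<omega>. Y j \<omega> = y j}) + card E * (H ^ N * \<kappa>)"
    by (simp add: sum.distrib prod.distrib w_def)
  also have "(\<Sum>y\<in>E. \<Prod>j<N. h j (y j) * measure_pmf.prob P {\<omega>. Y j \<omega> = y j})
     = (\<Prod>j<N. \<Sum>z\<in>R j. h j z * measure_pmf.prob P {\<omega>. Y j \<omega> = z})"
    unfolding E_def by (rule prod_sum_PiE[symmetric]) (auto intro: R)
  also have "\<dots> = (\<Prod>j<N. measure_pmf.expectation P (\<lambda>\<omega>. h j (Y j \<omega>)))"
  proof (rule prod.cong[OF refl])
    fix j assume "j \<in> {..<N}"
    then have "measure_pmf.expectation P (\<lambda>\<omega>. h j (Y j \<omega>))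
        = measure_pmf.expectation P (\<lambda>\<omega>. \<Sum>z\<in>R j. h j z * of_bool (Y j \<omega> = z))"
      by (intro cong expand) auto
    also have "\<dots> = (\<Sum>z\<in>R j. h j z * measure_pmf.prob P {\<omega>. Y j \<omega> = z})"
      by (simp only: sum scale expectation_of_bool)
    finally show "(\<Sum>z\<in>R j. h j z * measure_pmf.prob P {\<omega>. Y j \<omega> = z})
      = measure_pmf.expectation P (\<lambda>\<omega>. h j (Y j \<omega>))" ..
  qed
  also have "real (card E) = (\<Prod>j<N. real (card (R j)))"
    by (simp add: E_def card_PiE)
  finally show ?thesis .
qed

text \<open>Hoeffding's lemma for an interval of length 2, which gives the exponent
  \<open>t\<^sup>2 * 4 / 8\<close>.\<close>

lemma exp_moment_bounded:
  fixes s :: "'a \<Rightarrow> real"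
  assumes fin: "finite (set_pmf P)" and s: "\<And>\<omega>. \<omega> \<in> set_pmf P \<Longrightarrow> \<bar>s \<omega>\<bar> \<le> 1" and "0 < t"
  shows "measure_pmf.expectation P (\<lambda>\<omega>. exp (t * (s \<omega> - measure_pmf.expectation P s))) \<le> exp (t\<^sup>2 / 2)"
proof -
  have [simp]: "integrable (measure_pmf P) h" for h :: "'a \<Rightarrow> real"
    using fin by (rule integrable_measure_pmf_finite)
  define c where "c = measure_pmf.expectation P s"
  interpret interval_bounded_random_variable "measure_pmf P" "\<lambda>\<omega>. s \<omega> - c" "-1 - c" "1 - c"
    by unfold_locales (use s in \<open>force simp: AE_measure_pmf_iff abs_le_iff\<close>)+
  have "(\<integral>\<^sup>+ \<omega>. ennreal (exp (t * (s \<omega> - c))) \<partial>measure_pmf P) \<le> ennreal (exp (t\<^sup>2 * ((1 - c) - (-1 - c))\<^sup>2 / 8))"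
    by (rule Hoeffdings_lemma_nn_integral_0[OF \<open>0 < t\<close>]) (simp add: c_def)
  also have "(\<integral>\<^sup>+ \<omega>. ennreal (exp (t * (s \<omega> - c))) \<partial>measure_pmf P)
      = ennreal (measure_pmf.expectation P (\<lambda>\<omega>. exp (t * (s \<omega> - c))))"
    by (intro nn_integral_eq_integral) auto
  finally show ?thesis by (simp add: c_def)
qed

subsection \<open>Conditional expectations over nearly independent blocks\<close>

lemma markov_prob:
  fixes h :: "'b \<Rightarrow> real"
  assumes fin: "finite (set_pmf P)" and h: "\<And>\<omega>. \<omega> \<in> set_pmf P \<Longrightarrow> 0 \<le> h \<omega>"
    and "measure_pmf.expectation P h \<le> b * c" "0 < c"
  shows "1 - b \<le> measure_pmf.prob P {\<omega>. h \<omega> \<le> c}"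
proof -
  interpret averaging "set_pmf P" "measure_pmf.expectation P" by (rule averaging_pmf) fact
  have "c * (1 - measure_pmf.prob P {\<omega>. h \<omega> \<le> c})
      = measure_pmf.expectation P (\<lambda>\<omega>. c * (1 - of_bool (h \<omega> \<le> c)))"
    by (simp only: scale diff const expectation_of_bool)
  also have "\<dots> \<le> measure_pmf.expectation P h"
    by (rule mono) (use h \<open>0 < c\<close> in auto)
  also have "\<dots> \<le> c * b" using assms by (simp add: mult.commute)
  finally show ?thesis using \<open>0 < c\<close> by simp
qed

text \<open>\<open>cond_exp_disc\<close> depends on the outcome; this is the same quantity as a
  function of the value of \<open>Y\<close>, so that its sign is visibly a test function of
  \<open>Y\<close>.\<close>

definition cond_mean :: "'b pmf \<Rightarrow> ('b \<Rightarrow> real) \<Rightarrow> ('b \<Rightarrow> 'c) \<Rightarrow> 'c \<Rightarrow> real" where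
  "cond_mean P f Y z = measure_pmf.expectation P (\<lambda>\<omega>. of_bool (Y \<omega> = z) * f \<omega>) / measure_pmf.prob P {\<omega>. Y \<omega> = z}"

lemma cond_exp_disc_eq: "cond_exp_disc P f Y \<omega> = cond_mean P f Y (Y \<omega>)"
  by (simp add: cond_exp_disc_def cond_mean_def indicator_def)

lemma cond_mean_test:
  fixes h :: "'c \<Rightarrow> real"
  assumes fin: "finite (set_pmf P)"
  shows "measure_pmf.expectation P (\<lambda>\<omega>. cond_mean P f Y (Y \<omega>) * h (Y \<omega>))
       = measure_pmf.expectation P (\<lambda>\<omega>. f \<omega> * h (Y \<omega>))"
proof -
  interpret averaging "set_pmf P" "measure_pmf.expectation P" by (rule averaging_pmf) fact
  define R where "R = Y ` set_pmf P"
  have "finite R" using fin by (simp add: R_def)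
  have pt: "w (Y \<omega>) = (\<Sum>z\<in>R. w z * of_bool (Y \<omega> = z))" if "\<omega> \<in> set_pmf P" for w :: "'c \<Rightarrow> real" and \<omega>
  proof -
    have "(\<Sum>z\<in>R. w z * of_bool (Y \<omega> = z)) = (\<Sum>z\<in>R. if Y \<omega> = z then w z else 0)"
      by (rule sum.cong) auto
    then show ?thesis using \<open>finite R\<close> that by (simp add: R_def)
  qed
  have pos: "measure_pmf.prob P {\<omega>. Y \<omega> = z} > 0" if "z \<in> R" for z
    using that by (auto simp: R_def measure_pmf_zero_iff zero_less_measure_iff disjoint_iff)
  have "measure_pmf.expectation P (\<lambda>\<omega>. cond_mean P f Y (Y \<omega>) * h (Y \<omega>))
      = measure_pmf.expectation P (\<lambda>\<omega>. \<Sum>z\<in>R. (cond_mean P f Y z * h z) * of_bool (Y \<omega> = z))"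
    by (rule cong) (rule pt[where w = "\<lambda>z. cond_mean P f Y z * h z"])
  also have "\<dots> = (\<Sum>z\<in>R. (cond_mean P f Y z * h z) * measure_pmf.prob P {\<omega>. Y \<omega> = z})"
    by (simp only: sum scale expectation_of_bool)
  also have "\<dots> = (\<Sum>z\<in>R. h z * measure_pmf.expectation P (\<lambda>\<omega>. of_bool (Y \<omega> = z) * f \<omega>))"
    using pos by (intro sum.cong refl) (simp add: cond_mean_def less_imp_neq[symmetric])
  also have "\<dots> = measure_pmf.expectation P (\<lambda>\<omega>. \<Sum>z\<in>R. h z * (of_bool (Y \<omega> = z) * f \<omega>))"
    by (simp only: sum scale)
  also have "\<dots> = measure_pmf.expectation P (\<lambda>\<omega>. f \<omega> * h (Y \<omega>))"
  proof (rule cong)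
    fix \<omega> assume "\<omega> \<in> set_pmf P"
    then have "h (Y \<omega>) = (\<Sum>z\<in>R. h z * of_bool (Y \<omega> = z))" by (rule pt)
    then show "(\<Sum>z\<in>R. h z * (of_bool (Y \<omega> = z) * f \<omega>)) = f \<omega> * h (Y \<omega>)"
      by (simp add: sum_distrib_left mult_ac)
  qed
  finally show ?thesis .
qed

lemma cond_mean_L1:
  assumes fin: "finite (set_pmf P)"
  shows "measure_pmf.expectation P (\<lambda>\<omega>. \<bar>cond_mean P f Y (Y \<omega>)\<bar>)
       = measure_pmf.expectation P (\<lambda>\<omega>. f \<omega> * sgn (cond_mean P f Y (Y \<omega>)))"
  using cond_mean_test[OF fin, of f Y "\<lambda>z. sgn (cond_mean P f Y z)"] by (simp add: abs_sgn)

text \<open>The sign of the coarser conditional mean is a bounded function of \<open>Y\<close>,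
  hence a test function for the finer one. This carries the bound for a block over to each of its
  subsets.\<close>

lemma cond_mean_contraction:
  assumes fin: "finite (set_pmf P)"
  shows "measure_pmf.expectation P (\<lambda>\<omega>. \<bar>cond_mean P f (\<lambda>\<omega>. g (Y \<omega>)) (g (Y \<omega>))\<bar>)
       \<le> measure_pmf.expectation P (\<lambda>\<omega>. \<bar>cond_mean P f Y (Y \<omega>)\<bar>)"
proof -
  interpret averaging "set_pmf P" "measure_pmf.expectation P" by (rule averaging_pmf) fact
  define h where "h z = sgn (cond_mean P f (\<lambda>\<omega>. g (Y \<omega>)) (g z))" for z
  have "measure_pmf.expectation P (\<lambda>\<omega>. \<bar>cond_mean P f (\<lambda>\<omega>. g (Y \<omega>)) (g (Y \<omega>))\<bar>)
      = measure_pmf.expectation P (\<lambda>\<omega>. cond_mean P f Y (Y \<omega>) * h (Y \<omega>))"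
    using cond_mean_test[OF fin, of f Y h] cond_mean_L1[OF fin, of f "\<lambda>\<omega>. g (Y \<omega>)"] by (simp add: h_def)
  also have "\<dots> \<le> measure_pmf.expectation P (\<lambda>\<omega>. \<bar>cond_mean P f Y (Y \<omega>)\<bar>)"
    by (rule mono) (auto simp: h_def sgn_if)
  finally show ?thesis .
qed

text \<open>From \<open>ln y \<le> y - 1\<close> at \<open>y = 2 * x\<close>. Taking
  \<open>2 * x\<close> instead of \<open>x\<close> produces the factor
  \<open>exp (- q * ln 2)\<close>, at most \<open>1 / 4\<close> for \<open>2 \<le> q\<close>, which
  later absorbs the constant 4 from two exponential moments of size at most
  \<open>2 * exp q\<close>.\<close>

lemma powr_le_exp:
  fixes x q :: real
  assumes "0 \<le> x" "0 \<le> q"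
  shows "x powr q \<le> exp (- q - q * ln 2) * exp (2 * q * x)"
proof (cases "x = 0")
  case False
  then have "ln (2 * x) \<le> 2 * x - 1" using assms by (intro ln_le_minus_one) auto
  then have "ln x \<le> 2 * x - 1 - ln 2" using assms False by (simp add: ln_mult)
  then have "q * ln x \<le> q * (2 * x - 1 - ln 2)" using assms by (intro mult_left_mono) auto
  then show ?thesis
    using False by (simp add: powr_def exp_add[symmetric] algebra_simps)
qed (use assms in simp)

text \<open>A centred variable is at most 2, so \<open>exp (2 * t)\<close> serves as the bound
  \<open>H\<close> of \<open>expectation_prod_le\<close>; Hoeffding's lemma bounds the product of
  the expectations.\<close>

lemma exp_moment_sum:
  fixes Y :: "nat \<Rightarrow> 'b \<Rightarrow> 'c" and s :: "nat \<Rightarrow> 'c \<Rightarrow> real"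
  assumes fin: "finite (set_pmf P)" and R: "\<And>j. j < N \<Longrightarrow> finite (R j)"
    and Y: "\<And>j \<omega>. j < N \<Longrightarrow> \<omega> \<in> set_pmf P \<Longrightarrow> Y j \<omega> \<in> R j"
    and ind: "\<And>y. (\<And>j. j < N \<Longrightarrow> y j \<in> R j) \<Longrightarrow>
      \<bar>measure_pmf.prob P {\<omega>. \<forall>j<N. Y j \<omega> = y j} - (\<Prod>j<N. measure_pmf.prob P {\<omega>. Y j \<omega> = y j})\<bar> \<le> \<kappa>"
    and s: "\<And>j z. \<bar>s j z\<bar> \<le> 1" and "0 < t" "0 \<le> \<kappa>"
  shows "measure_pmf.expectation P (\<lambda>\<omega>. exp (t * (\<Sum>j<N. s j (Y j \<omega>) - measure_pmf.expectation P (\<lambda>\<omega>. s j (Y j \<omega>)))))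
    \<le> exp (N * (t\<^sup>2 / 2)) + (\<Prod>j<N. real (card (R j))) * (exp (2 * t * real N) * \<kappa>)"
proof -
  interpret averaging "set_pmf P" "measure_pmf.expectation P" by (rule averaging_pmf) fact
  define c where "c j = measure_pmf.expectation P (\<lambda>\<omega>. s j (Y j \<omega>))" for j
  define h where "h j z = exp (t * (s j z - c j))" for j z
  have c: "-1 \<le> c j" "c j \<le> 1" for j
    unfolding c_def using s by (intro lower upper; simp add: abs_le_iff minus_le_iff)+
  have "measure_pmf.expectation P (\<lambda>\<omega>. \<Prod>j<N. h j (Y j \<omega>))
    \<le> (\<Prod>j<N. measure_pmf.expectation P (\<lambda>\<omega>. h j (Y j \<omega>))) + (\<Prod>j<N. real (card (R j))) * (exp (2 * t) ^ N * \<kappa>)"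
  proof (rule expectation_prod_le[OF fin R Y ind])
    fix j z
    have "s j z - c j \<le> 2" using s[of j z] c[of j] by linarith
    then show "h j z \<le> exp (2 * t)" using \<open>0 < t\<close> by (simp add: h_def mult.commute)
  qed (use assms in \<open>auto simp: h_def\<close>)
  also have "(\<Prod>j<N. measure_pmf.expectation P (\<lambda>\<omega>. h j (Y j \<omega>))) \<le> (\<Prod>j<N. exp (t\<^sup>2 / 2))"
  proof (intro prod_mono conjI)
    fix j
    show "0 \<le> measure_pmf.expectation P (\<lambda>\<omega>. h j (Y j \<omega>))" by (rule nonneg) (simp add: h_def)
    show "measure_pmf.expectation P (\<lambda>\<omega>. h j (Y j \<omega>)) \<le> exp (t\<^sup>2 / 2)"
      unfolding h_def c_def using s by (intro exp_moment_bounded[OF fin _ \<open>0 < t\<close>]) auto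
  qed
  finally show ?thesis
    by (simp add: h_def c_def exp_sum[symmetric] sum_distrib_left exp_of_nat_mult[symmetric] mult_ac)
qed

text \<open>Duality: the left-hand side is the expectation of \<open>f\<close> times the sum of the signs of the conditional
  expectations, and these signs may be centred because \<open>f\<close> has mean zero.\<close>

lemma sum_cond_mean_L1:
  fixes Y :: "nat \<Rightarrow> 'b \<Rightarrow> 'c" and f :: "'b \<Rightarrow> real"
  assumes fin: "finite (set_pmf P)" and R: "\<And>j. j < N \<Longrightarrow> finite (R j)"
    and Y: "\<And>j \<omega>. j < N \<Longrightarrow> \<omega> \<in> set_pmf P \<Longrightarrow> Y j \<omega> \<in> R j"
    and ind: "\<And>y. (\<And>j. j < N \<Longrightarrow> y j \<in> R j) \<Longrightarrow>
      \<bar>measure_pmf.prob P {\<omega>. \<forall>j<N. Y j \<omega> = y j} - (\<Prod>j<N. measure_pmf.prob P {\<omega>. Y j \<omega> = y j})\<bar> \<le> \<kappa>"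
    and p: "1 < p" "p \<le> 2" and \<delta>: "0 < \<delta>" "\<delta> \<le> 1" and "0 \<le> \<kappa>"
    and N: "2 * (p / (p - 1)) / \<delta>\<^sup>2 \<le> N"
    and small: "(\<Prod>j<N. real (card (R j))) * \<kappa> * exp (2 * real N) \<le> 1"
    and f: "measure_pmf.expectation P f = 0" "measure_pmf.expectation P (\<lambda>\<omega>. \<bar>f \<omega>\<bar> powr p) = 1"
  shows "(\<Sum>j<N. measure_pmf.expectation P (\<lambda>\<omega>. \<bar>cond_mean P f (Y j) (Y j \<omega>)\<bar>)) \<le> N * \<delta>"
proof -
  interpret averaging "set_pmf P" "measure_pmf.expectation P" by (rule averaging_pmf) fact
  define q where "q = p / (p - 1)"
  have q: "2 \<le> q" "1 / p + 1 / q = 1" using p by (auto simp: q_def field_simps)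
  define s where "s j z = sgn (cond_mean P f (Y j) z)" for j z
  have s1: "\<bar>s j z\<bar> \<le> 1" for j z by (simp add: s_def sgn_if)
  define \<Phi> where "\<Phi> \<omega> = (\<Sum>j<N. s j (Y j \<omega>) - measure_pmf.expectation P (\<lambda>\<omega>. s j (Y j \<omega>)))" for \<omega>
  define C where "C = (\<Prod>j<N. real (card (R j)))"
  have "0 \<le> C" unfolding C_def by (rule prod_nonneg) simp
  have Nq: "2 * q \<le> N * \<delta>\<^sup>2" using N \<delta> unfolding q_def by (simp only: pos_divide_le_eq zero_less_power)
  then have "0 < N * \<delta>\<^sup>2" using q by linarith
  then have "0 < real N" using \<delta> by (simp add: zero_less_mult_iff)
  \<comment> \<open>This makes \<open>t * \<bar>\<Phi> \<omega>\<bar>\<close> equal to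
    \<open>2 * q * x \<omega>\<close> with \<open>x\<close> as below, the exponent in
    \<open>powr_le_exp\<close>. The lower bound on \<open>N\<close> says exactly that
    \<open>N * (t\<^sup>2 / 2)\<close> is at most \<open>q\<close>, and it implies
    \<open>t \<le> 1\<close>, so that the assumption \<open>small\<close> controls the error
    term.\<close>
  define t where "t = 2 * q / (N * \<delta>)"
  have "0 < t" using q \<delta> \<open>0 < real N\<close> by (simp add: t_def)
  have t1: "N * (t\<^sup>2 / 2) \<le> q"
  proof -
    have "N * (t\<^sup>2 / 2) = q * (2 * q / (N * \<delta>\<^sup>2))"
      using \<open>0 < real N\<close> \<delta> by (simp add: t_def power2_eq_square field_simps)
    also have "\<dots> \<le> q * 1" using Nq \<open>0 < N * \<delta>\<^sup>2\<close> q by (intro mult_left_mono) auto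
    finally show ?thesis by simp
  qed
  have t2: "2 * t * N \<le> 2 * N"
  proof -
    have "\<delta>\<^sup>2 \<le> \<delta>" using \<delta> by (simp add: power2_eq_square mult_left_le)
    then have "2 * q \<le> N * \<delta>"
      using Nq mult_left_mono[of "\<delta>\<^sup>2" \<delta> "real N"] by linarith
    then have "t \<le> 1" using \<open>0 < real N\<close> \<delta> by (simp add: t_def)
    then show ?thesis by (simp add: mult_left_le_one_le mult_right_mono)
  qed
  have bound: "exp (N * (t\<^sup>2 / 2)) + C * (exp (2 * t * real N) * \<kappa>) \<le> 2 * exp q"
  proof -
    have "C * (exp (2 * t * real N) * \<kappa>) \<le> C * (exp (2 * real N) * \<kappa>)"
      using t2 \<open>0 \<le> C\<close> \<open>0 \<le> \<kappa>\<close> by (intro mult_left_mono mult_right_mono) auto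
    also have "\<dots> \<le> 1" using small by (simp add: C_def mult_ac)
    also have "1 \<le> exp q" using q by simp
    finally show ?thesis using t1 exp_le_cancel_iff[of "N * (t\<^sup>2 / 2)" q] by linarith
  qed
  have plus: "measure_pmf.expectation P (\<lambda>\<omega>. exp (t * \<Phi> \<omega>)) \<le> 2 * exp q"
    using order_trans[OF exp_moment_sum[OF fin R Y ind s1 \<open>0 < t\<close> \<open>0 \<le> \<kappa>\<close>] bound[unfolded C_def]]
    by (simp add: \<Phi>_def)
  \<comment> \<open>The exponential moment bound is one-sided; the lower tail comes from the
    opposite signs \<open>- s\<close>.\<close>
  have minus: "measure_pmf.expectation P (\<lambda>\<omega>. exp (- t * \<Phi> \<omega>)) \<le> 2 * exp q"
  proof -
    have "measure_pmf.expectation P (\<lambda>\<omega>. exp (t * (\<Sum>j<N. - s j (Y j \<omega>) - measure_pmf.expectation P (\<lambda>\<omega>. - s j (Y j \<omega>))))) \<le> 2 * exp q"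
      using order_trans[OF exp_moment_sum[OF fin R Y ind _ \<open>0 < t\<close> \<open>0 \<le> \<kappa>\<close>, of "\<lambda>j z. - s j z"] bound[unfolded C_def]] s1
      by simp
    moreover have "(\<Sum>j<N. - s j (Y j \<omega>) - measure_pmf.expectation P (\<lambda>\<omega>. - s j (Y j \<omega>))) = - \<Phi> \<omega>" for \<omega>
      unfolding \<Phi>_def sum_negf[symmetric] by (rule sum.cong) simp_all
    ultimately show ?thesis by simp
  qed
  define x where "x \<omega> = \<bar>\<Phi> \<omega>\<bar> / (N * \<delta>)" for \<omega>
  have xq: "x \<omega> powr q \<le> exp (- q - q * ln 2) * (exp (t * \<Phi> \<omega>) + exp (- t * \<Phi> \<omega>))" for \<omega>
  proof -
    have "x \<omega> powr q \<le> exp (- q - q * ln 2) * exp (2 * q * x \<omega>)"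
      using q \<delta> by (intro powr_le_exp) (simp_all add: x_def)
    also have "2 * q * x \<omega> = t * \<bar>\<Phi> \<omega>\<bar>" by (simp add: x_def t_def)
    also have "exp (t * \<bar>\<Phi> \<omega>\<bar>) \<le> exp (t * \<Phi> \<omega>) + exp (- t * \<Phi> \<omega>)"
      by (cases "0 \<le> \<Phi> \<omega>") simp_all
    finally show ?thesis by simp
  qed
  have Exq: "measure_pmf.expectation P (\<lambda>\<omega>. x \<omega> powr q) \<le> 1"
  proof -
    have "measure_pmf.expectation P (\<lambda>\<omega>. x \<omega> powr q)
        \<le> measure_pmf.expectation P (\<lambda>\<omega>. exp (- q - q * ln 2) * (exp (t * \<Phi> \<omega>) + exp (- t * \<Phi> \<omega>)))"
      by (intro mono xq)
    also have "\<dots> = exp (- q - q * ln 2) * (measure_pmf.expectation P (\<lambda>\<omega>. exp (t * \<Phi> \<omega>))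
        + measure_pmf.expectation P (\<lambda>\<omega>. exp (- t * \<Phi> \<omega>)))"
      by (simp only: scale add)
    also have "\<dots> \<le> exp (- q - q * ln 2) * (4 * exp q)"
      using plus minus by (intro mult_left_mono) auto
    also have "\<dots> = 4 * exp (- (q * ln 2))" by (simp add: exp_add[symmetric] exp_diff exp_minus field_simps)
    also have "\<dots> \<le> 4 * exp (- (2 * ln 2))" using q by simp
    also have "exp (- (2 * ln 2 :: real)) = 1 / 4"
      using exp_double[of "ln 2 :: real"] by (simp add: exp_minus field_simps)
    finally show ?thesis by simp
  qed
  have "(\<Sum>j<N. measure_pmf.expectation P (\<lambda>\<omega>. \<bar>cond_mean P f (Y j) (Y j \<omega>)\<bar>))
      = measure_pmf.expectation P (\<lambda>\<omega>. \<Sum>j<N. f \<omega> * s j (Y j \<omega>))"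
    unfolding sum by (simp add: cond_mean_L1[OF fin] s_def)
  also have "\<dots> = measure_pmf.expectation P (\<lambda>\<omega>. f \<omega> * \<Phi> \<omega>)"
  proof -
    have "f \<omega> * \<Phi> \<omega> = (\<Sum>j<N. f \<omega> * s j (Y j \<omega>))
        - (\<Sum>j<N. measure_pmf.expectation P (\<lambda>\<omega>. s j (Y j \<omega>))) * f \<omega>" for \<omega>
      by (simp add: \<Phi>_def sum_subtractf right_diff_distrib sum_distrib_left mult.commute)
    then show ?thesis by (simp add: diff scale f)
  qed
  \<comment> \<open>Young's inequality does the work of Hoelder's, since the moments of
    \<open>f\<close> and \<open>x\<close> are already at most 1 and the weights \<open>1 / p\<close>
    and \<open>1 / q\<close> add up to 1.\<close>
  also have "\<dots> \<le> measure_pmf.expectation P (\<lambda>\<omega>. (N * \<delta>) * ((1 / p) * \<bar>f \<omega>\<bar> powr p + (1 / q) * x \<omega> powr q))"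
  proof (rule mono)
    fix \<omega>
    have "f \<omega> * \<Phi> \<omega> \<le> \<bar>f \<omega>\<bar> * \<bar>\<Phi> \<omega>\<bar>" by (simp add: abs_mult[symmetric])
    also have "\<dots> = (N * \<delta>) * (\<bar>f \<omega>\<bar> * x \<omega>)" using \<open>0 < real N\<close> \<delta> by (simp add: x_def)
    also have "\<bar>f \<omega>\<bar> * x \<omega> \<le> \<bar>f \<omega>\<bar> powr p / p + x \<omega> powr q / q"
      using p q \<delta> by (intro Youngs_inequality) (auto simp: x_def)
    finally show "f \<omega> * \<Phi> \<omega> \<le> (N * \<delta>) * ((1 / p) * \<bar>f \<omega>\<bar> powr p + (1 / q) * x \<omega> powr q)"
      using \<delta> by (simp add: mult_left_mono)
  qed
  also have "\<dots> = (N * \<delta>) * (1 / p + (1 / q) * measure_pmf.expectation P (\<lambda>\<omega>. x \<omega> powr q))"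
    by (simp only: add scale f) simp
  also have "\<dots> \<le> (N * \<delta>) * (1 / p + (1 / q) * 1)"
    using Exq \<delta> q by (intro mult_left_mono add_left_mono) auto
  also have "\<dots> = N * \<delta>" using q by simp
  finally show ?thesis .
qed

subsection \<open>Numerical bounds\<close>

text \<open>\<open>N\<close> is at most \<open>5 * b\<close>, while \<open>A\<close> is at least
  \<open>256 * b\<close>, so \<open>50 * N \<le> A\<close>. With \<open>150 = 24 * 50 / 8\<close>,
  the inequality \<open>8 ^ d * (A / 8) \<le> A ^ d\<close> leaves a factor \<open>8 ^ d\<close> in
  reserve for the roots taken in \<open>decouple\<close>.\<close>

lemma exponent_bound:
  fixes d m k :: nat and p \<epsilon> :: real
  assumes d: "1 \<le> d" and m: "2 \<le> m" and p: "1 < p" "p \<le> 2" and \<epsilon>: "0 < \<epsilon>" "\<epsilon> \<le> 1"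
    and N: "real N \<le> 2 * (p / (p - 1)) / (\<epsilon> ^ 3)\<^sup>2 + 1"
  shows "150 * 8 ^ d * (d * N * k ^ d * ln m) \<le> 24 * real d * ln (real m) / ((\<epsilon> ^ 3 / 4) ^ (4 * d) * (p - 1) ^ d) * real k ^ d"
proof -
  define A where "A = 1 / ((\<epsilon> ^ 3 / 4) ^ 4 * (p - 1))"
  define b where "b = 1 / ((p - 1) * \<epsilon> ^ 6)"
  have pos: "0 < p - 1" "0 < \<epsilon> ^ 6" using p \<epsilon> by auto
  have "\<epsilon> ^ 6 \<le> 1" using \<epsilon> by (intro power_le_one) auto
  then have "(p - 1) * \<epsilon> ^ 6 \<le> 1" using p \<epsilon> by (intro mult_le_one) auto
  then have "1 \<le> b" using pos by (simp add: b_def)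
  have "\<epsilon> ^ 12 \<le> \<epsilon> ^ 6" using \<epsilon> by (intro power_decreasing) auto
  then have Ab: "256 * b \<le> A"
    using pos by (simp add: A_def b_def power_divide power_mult[symmetric] divide_simps mult_left_mono)
  have "2 * (p / (p - 1)) / (\<epsilon> ^ 3)\<^sup>2 \<le> 4 * b"
    using p pos by (simp add: b_def power_mult[symmetric] divide_simps)
  then have NA: "50 * real N \<le> A" using N Ab \<open>1 \<le> b\<close> by linarith
  have A8: "1 \<le> A / 8" using Ab \<open>1 \<le> b\<close> by linarith
  have "8 ^ d * (A / 8) \<le> 8 ^ d * (A / 8) ^ d"
    using A8 d by (intro mult_left_mono self_le_power) auto
  also have "\<dots> = A ^ d" by (simp add: power_divide)
  finally have Ad: "8 ^ d * (A / 8) \<le> A ^ d" .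
  have ln: "0 \<le> ln (real m)" using m by simp
  have "150 * 8 ^ d * (d * N * k ^ d * ln m) = 24 * d * ln m * k ^ d * (8 ^ d * (50 * real N / 8))"
    by simp
  also have "\<dots> \<le> 24 * d * ln m * k ^ d * A ^ d"
    using NA ln by (intro mult_left_mono order_trans[OF _ Ad]) auto
  also have "\<dots> = 24 * real d * ln (real m) / ((\<epsilon> ^ 3 / 4) ^ (4 * d) * (p - 1) ^ d) * real k ^ d"
  proof -
    have "A ^ d = 1 / ((\<epsilon> ^ 3 / 4) ^ (4 * d) * (p - 1) ^ d)"
      unfolding A_def power_one_over power_mult_distrib power_mult ..
    then show ?thesis by simp
  qed
  finally show ?thesis .
qed

text \<open>The logarithms of all sizes are bounded by multiples of \<open>w\<close>, whereas
  \<open>decouple\<close> leaves a decay of \<open>exp (- L8 / 2)\<close> with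
  \<open>150 * w \<le> L8\<close>. At the end a decay exponent of \<open>75 * w\<close> meets a
  growth exponent of at most \<open>26 * w + 3 * w\<close>.\<close>

lemma parameter_bounds:
  fixes d m k n N :: nat and L :: real
  assumes d: "1 \<le> d" and m: "2 \<le> m" and k: "d \<le> k" and N: "1 \<le> N"
    and L: "150 * 8 ^ d * (d * N * k ^ d * ln m) \<le> L" and n: "exp L \<le> n"
  defines "M \<equiv> n div (N * k)" and "\<eta> \<equiv> 1 / exp L"
  defines "e \<equiv> (2 ^ d + 2) * \<eta> + d / M"
  defines "\<rho> \<equiv> real m * ((2 ^ 2 ^ d * (12 * e powr (1 / 4 ^ d))) powr (1 / 2 ^ d) + 3 * \<eta>)"
  shows "1 \<le> M" "M * (N * k) \<le> n" "2 * d \<le> n" "d \<le> N * k" "e \<le> 1" "0 \<le> e"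
    "(real m ^ (k choose d)) ^ N * (2 * real (N * (k choose d)) * \<rho>) * exp (2 * real N) \<le> 1"
proof -
  define w where "w = d * N * k ^ d * ln (real m)"
  have "ln 2 \<le> ln (real m)" using m by simp
  \<comment> \<open>For \<open>m = 2\<close> the logarithm is below 1; the bound
    \<open>2 / 3\<close> is the origin of the ratio \<open>3 / 2\<close> in the comparisons with
    \<open>w\<close>.\<close>
  then have ln: "2 / 3 \<le> ln (real m)" using ln2_ge_two_thirds by linarith
  have lower: "2 * x \<le> 3 * w" if "x \<le> real d * real N * real k ^ d" for x
  proof -
    have "x * (2 / 3) \<le> (real d * real N * real k ^ d) * (2 / 3)" using that by simp
    also have "\<dots> \<le> w"       using mult_left_mono[OF ln, of "real d * real N * real k ^ d"] by (simp add: w_def)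
    finally show ?thesis by simp
  qed
  have nat_lower: "2 * real x \<le> 3 * w" if "x \<le> d * N * k ^ d" for x
    using lower[of "real x"] that by (metis of_nat_le_iff of_nat_mult of_nat_power)
  have kd: "k \<le> k ^ d" using d k by (intro self_le_power) auto
  have k1: "1 \<le> k ^ d" using d k by simp
  have w1: "2 \<le> 3 * w" using nat_lower[of 1] d N k1 by (simp add: Suc_le_eq)
  have wdNk: "2 * (real d * N * k) \<le> 3 * w"
    using nat_lower[of "d * N * k"] kd by simp
  have wN: "2 * real N \<le> 3 * w"
    using nat_lower[of N] d k1 mult_le_mono[of 1 d 1 "k ^ d"] mult_le_mono[of 1 "d * k ^ d" N N]
    by (simp add: mult_ac)
  have wk: "2 * real (N * k) \<le> 3 * w"
    using nat_lower[of "N * k"] kd mult_le_mono[of 1 d "N * k" "N * k ^ d"] d by (simp add: mult_ac)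
  define T where "T = N * (k choose d)"
  have "k choose d \<le> k ^ d" using k by (rule binomial_le_pow)
  then have Td: "T \<le> d * N * k ^ d"
    using d mult_le_mono[of 1 d "N * (k choose d)" "N * k ^ d"] by (simp add: T_def mult_ac)
  then have wT: "2 * real T \<le> 3 * w" by (rule nat_lower)
  have Tln: "T * ln (real m) \<le> w"
  proof -
    have "real T \<le> real (d * N * k ^ d)" using Td by (rule of_nat_mono)
    then show ?thesis unfolding w_def using ln by (simp add: mult_right_mono)
  qed
  have T1: "1 \<le> T" using N k by (simp add: T_def Suc_le_eq)
  have mw: "real m \<le> exp w"
  proof -
    have "1 * ln (real m) \<le> T * ln (real m)" using T1 ln by (intro mult_right_mono) auto
    then have "exp (ln (real m)) \<le> exp w" using Tln by simp
    then show ?thesis using m by simp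
  qed
  \<comment> \<open>The power \<open>1 / 4 ^ d\<close> and the root \<open>1 / 2 ^ d\<close>
    together divide the exponent by \<open>8 ^ d\<close>.\<close>
  define L8 where "L8 = L / 8 ^ d"
  have LL8: "L = 8 ^ d * L8" by (simp add: L8_def)
  have L8: "150 * w \<le> L8" using L by (simp add: L8_def w_def field_simps)
  have d8: "(8::real) \<le> 8 ^ d" using d self_le_power[of "8::real" d] by simp
  have "2 ^ d \<le> (8::real) ^ d" by (rule power_mono) auto
  have Lw: "150 * (8 ^ d * w) \<le> L" using L8 by (simp add: LL8)
  have w8: "8 * w \<le> 8 ^ d * w" using d8 w1 by (intro mult_right_mono) auto
  have "0 < L" using w1 w8 Lw by linarith
  have expL: "1 + L \<le> exp L" by (rule exp_ge_add_one_self)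
  have expL2: "1 + L / 2 \<le> exp (L / 2)" by (rule exp_ge_add_one_self)
  have \<eta>: "\<eta> = exp (- L)" by (simp add: \<eta>_def exp_minus inverse_eq_divide)
  define l where "l = N * k"
  have l0: "0 < l" using N k d by (simp add: l_def)
  have ln2: "2 * real l \<le> n" using n expL wk w8 Lw w1 unfolding l_def by linarith
  show "d \<le> N * k" using N k mult_le_mono[of 1 N d k] by simp
  have "real d \<le> real l" using \<open>d \<le> N * k\<close> unfolding l_def by (rule of_nat_mono)
  then have "2 * real d \<le> real n" using ln2 by linarith
  then show "2 * d \<le> n" by linarith
  have M: "M = n div l" by (simp add: M_def l_def)
  have "2 * l \<le> n" using ln2 by linarith
  then show M1: "1 \<le> M" using l0 by (simp add: M Suc_le_eq div_greater_zero_iff)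
  show "M * (N * k) \<le> n" by (simp add: M_def)
  \<comment> \<open>Rounding down loses at most a factor 2, as \<open>1 \<le> M\<close>.\<close>
  have "n < (M + 1) * l" using l0 unfolding M by (simp add: dividend_less_div_times)
  also have "(M + 1) * l \<le> 2 * M * l" using M1 by simp
  finally have "real n \<le> real (2 * M * l)" by linarith
  then have "exp L \<le> 2 * real M * l" using n by simp
  then have "1 / real M \<le> 2 * l * \<eta>"
    using M1 by (simp add: \<eta>_def field_simps)
  then have "d * (1 / real M) \<le> d * (2 * l * \<eta>)" by (intro mult_left_mono) auto
  then have "e \<le> (2 ^ d + 2 + 2 * (real d * N * k)) * \<eta>" by (simp add: e_def l_def algebra_simps)
  \<comment> \<open>Half of the exponent of \<open>\<eta> = exp (- L)\<close> absorbs the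
    prefactor.\<close>
  also have "\<dots> \<le> exp (L / 2) * \<eta>"
  proof (rule mult_right_mono)
    have "2 * 2 ^ d \<le> 3 * ((8::real) ^ d * w)"
    proof -
      have "8 ^ d * 2 \<le> (8::real) ^ d * (3 * w)" using w1 by (intro mult_left_mono) auto
      then show ?thesis using \<open>2 ^ d \<le> (8::real) ^ d\<close> by linarith
    qed
    then have "2 ^ d + 2 + 2 * (real d * N * k) \<le> L / 2" using wdNk w1 w8 Lw by linarith
    then show "2 ^ d + 2 + 2 * (real d * N * k) \<le> exp (L / 2)" using expL2 by linarith
  qed (simp add: \<eta>_def)
  also have "\<dots> = exp (- L / 2)"
    by (simp only: \<eta> exp_add[symmetric]) simp
  finally have e: "e \<le> exp (- L / 2)" .
  also have "\<dots> \<le> 1" using \<open>0 < L\<close> by simp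
  finally show "e \<le> 1" .
  show e0: "0 \<le> e" by (simp add: e_def \<eta>_def)
  have main: "(2 ^ 2 ^ d * (12 * e powr (1 / 4 ^ d))) powr (1 / 2 ^ d) \<le> 24 * exp (- L8 / 2)"
  proof -
    have "(2 ^ 2 ^ d * (12 * e powr (1 / 4 ^ d))) powr (1 / 2 ^ d)
        \<le> (2 ^ 2 ^ d * (12 * exp (- L / 2) powr (1 / 4 ^ d))) powr (1 / 2 ^ d)"
      using e e0 by (intro powr_mono2 mult_left_mono) auto
    also have "\<dots> = (2 ^ 2 ^ d) powr (1 / 2 ^ d) * (12 powr (1 / 2 ^ d) * exp (- L / 2) powr (1 / 4 ^ d * (1 / 2 ^ d)))"
      by (simp add: powr_mult powr_powr)
    also have "(2 ^ 2 ^ d) powr (1 / 2 ^ d) = (2::real)"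
      by (simp add: powr_realpow[symmetric] powr_powr)
    also have "exp (- L / 2) powr (1 / 4 ^ d * (1 / 2 ^ d)) = exp (- L8 / 2)"
      by (simp add: exp_powr_real L8_def power_mult_distrib[symmetric])
    also have "2 * (12 powr (1 / 2 ^ d) * exp (- L8 / 2)) \<le> 2 * (12 powr 1 * exp (- L8 / 2))"
      by (intro mult_left_mono mult_right_mono powr_mono) auto
    finally show ?thesis by simp
  qed
  have "\<eta> \<le> exp (- L8 / 2)"
  proof -
    have "L8 \<le> L" using \<open>0 < L\<close> by (simp add: L8_def divide_le_eq mult_le_cancel_left1)
    then show ?thesis using \<open>0 < L\<close> by (simp add: \<eta>)
  qed
  then have "\<rho> \<le> real m * (27 * exp (- L8 / 2))"
    using main unfolding \<rho>_def by (intro mult_left_mono) auto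
  also have "\<dots> \<le> exp w * (27 * exp (- L8 / 2))" using mw by (intro mult_right_mono) auto
  finally have \<rho>: "\<rho> \<le> exp w * (27 * exp (- L8 / 2))" .
  \<comment> \<open>Here \<open>54 = 2 * 27\<close>, where 27 collects 24 from the root and 3 from
    \<open>3 * \<eta>\<close>; the square absorbs the constant because
    \<open>1 \<le> T\<close>.\<close>
  have "54 * real T \<le> (8 * real T)\<^sup>2" using T1 by (simp add: power2_eq_square)
  also have "\<dots> \<le> (exp (8 * real T))\<^sup>2"
  proof (rule power_mono)
    show "8 * real T \<le> exp (8 * real T)" using exp_ge_add_one_self[of "8 * real T"] by linarith
  qed simp
  also have "\<dots> = exp (16 * real T)" by (simp add: exp_double[symmetric])
  also have "\<dots> \<le> exp (24 * w)" using wT by simp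
  finally have T54: "54 * real T \<le> exp (24 * w)" .
  have mT: "(real m ^ (k choose d)) ^ N \<le> exp w"
  proof -
    have "(real m ^ (k choose d)) ^ N = real m ^ T" by (simp add: T_def power_mult[symmetric] mult.commute)
    also have "\<dots> = exp (T * ln (real m))" using m by (simp add: exp_of_nat_mult)
    also have "\<dots> \<le> exp w" using Tln by simp
    finally show ?thesis .
  qed
  have "2 * real T * \<rho> \<le> 2 * real T * (exp w * (27 * exp (- L8 / 2)))"
    using \<rho> by (intro mult_left_mono) auto
  also have "\<dots> = 54 * real T * exp (w - L8 / 2)" by (simp add: exp_add[symmetric] algebra_simps)
  also have "\<dots> \<le> exp (24 * w) * exp (w - L8 / 2)" using T54 by (intro mult_right_mono) auto
  also have "\<dots> = exp (25 * w - L8 / 2)" by (simp add: exp_add[symmetric])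
  finally have 1: "2 * real T * \<rho> \<le> exp (25 * w - L8 / 2)" .
  have "(real m ^ (k choose d)) ^ N * (2 * real T * \<rho>) \<le> exp w * exp (25 * w - L8 / 2)"
    using mT 1 by (intro mult_mono) (auto simp: \<rho>_def \<eta>_def)
  then have "(real m ^ (k choose d)) ^ N * (2 * real T * \<rho>) * exp (2 * real N) \<le> exp w * exp (25 * w - L8 / 2) * exp (2 * real N)"
    by (intro mult_right_mono) auto
  also have "\<dots> = exp (26 * w - L8 / 2 + 2 * real N)" by (simp add: exp_add[symmetric])
  also have "\<dots> \<le> 1" using wN L8 w1 by simp
  finally show "(real m ^ (k choose d)) ^ N * (2 * real (N * (k choose d)) * \<rho>) * exp (2 * real N) \<le> 1"
    by (simp only: T_def)
qed

subsection \<open>Blocks of consecutive vertices\<close>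

lemma card_nsubsets: "finite I \<Longrightarrow> card (nsubsets I d) = card I choose d"
  unfolding nsubsets_def by (rule n_subsets)

lemma finite_nsubsets: "finite I \<Longrightarrow> finite (nsubsets I d)"
  by (simp add: nsubsets_def)

text \<open>Normalising the entries off the index set to \<open>undefined\<close> leaves only
  finitely many arrays.\<close>

lemma random_array_finite:
  assumes "random_array n d A P" "finite A"
  shows "finite (set_pmf P)"
proof (rule finite_subset)
  show "set_pmf P \<subseteq> PiE (nsubsets {1..n} d) (\<lambda>_. A)"
  proof
    fix \<omega> assume "\<omega> \<in> set_pmf P"
    then have *: "restr_arr {1..n} d \<omega> = \<omega>" "\<And>s. s \<in> nsubsets {1..n} d \<Longrightarrow> \<omega> s \<in> A"
      using assms(1) by (auto simp: random_array_def)
    have "\<omega> s = undefined" if "s \<notin> nsubsets {1..n} d" for s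
      using fun_cong[OF *(1), of s] that by (simp add: restr_arr_def)
    then show "\<omega> \<in> PiE (nsubsets {1..n} d) (\<lambda>_. A)" using *(2) by auto
  qed
  show "finite (PiE (nsubsets {1..n} d) (\<lambda>_. A))"
    using assms(2) by (intro finite_PiE finite_nsubsets) auto
qed

definition block :: "nat \<Rightarrow> nat \<Rightarrow> nat set" where
  "block k j = {j * k + 1..<j * k + 1 + k}"

lemma block_subset: "j < N \<Longrightarrow> block k j \<subseteq> {1..N * k}"
proof -
  assume "j < N"
  then have "(j + 1) * k \<le> N * k" by (intro mult_le_mono) auto
  then show ?thesis by (auto simp: block_def)
qed

lemma block_disjoint:
  assumes "i \<noteq> j"
  shows "block k i \<inter> block k j = {}"
proof -
  have "block k i \<inter> block k j = {}" if "i < j" for i j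
  proof -
    have "(i + 1) * k \<le> j * k" using that by (intro mult_le_mono) auto
    then show ?thesis by (auto simp: block_def)
  qed
  then show ?thesis using assms by (metis Int_commute linorder_neqE_nat)
qed

text \<open>The bound is on the sum over all blocks because the good blocks may depend on
  \<open>v\<close>; one is chosen only after averaging over \<open>v\<close>.\<close>

lemma block_conditioning:
  fixes d m k n N :: nat and p \<epsilon> L :: real and P :: "(nat set \<Rightarrow> 'a) pmf" and f :: "(nat set \<Rightarrow> 'a) \<Rightarrow> real"
  assumes d: "1 \<le> d" and m: "2 \<le> m" and p: "1 < p" "p \<le> 2" and \<epsilon>: "0 < \<epsilon>" "\<epsilon> \<le> 1" and k: "d \<le> k"
    and N: "1 \<le> N" "2 * (p / (p - 1)) / (\<epsilon> ^ 3)\<^sup>2 \<le> N"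
    and L: "150 * 8 ^ d * (d * N * k ^ d * ln m) \<le> L" and n: "exp L \<le> n"
    and A: "card A = m" "random_array n d A P"
    and sp: "spreadable (1 / exp L) n d P"
    and S: "S \<subseteq> A" "card S = card A - 1"
      "\<And>a. a \<in> S \<Longrightarrow> \<bar>measure_pmf.prob P {\<omega>. \<forall>s\<in>Box n d. \<omega> s = a}
          - (\<Prod>s\<in>Box n d. measure_pmf.prob P {\<omega>. \<omega> s = a})\<bar> \<le> 1 / exp L"
    and f: "measure_pmf.expectation P f = 0" "measure_pmf.expectation P (\<lambda>\<omega>. \<bar>f \<omega>\<bar> powr p) = 1"
  shows "(\<Sum>j<N. measure_pmf.expectation P
      (\<lambda>\<omega>. \<bar>cond_mean P f (restr_arr (block k j) d) (restr_arr (block k j) d \<omega>)\<bar>)) \<le> N * \<epsilon> ^ 3"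
proof -
  define M where "M = n div (N * k)"
  define \<eta> where "\<eta> = 1 / exp L"
  define e where "e = (2 ^ d + 2) * \<eta> + d / M"
  define \<rho>0 where "\<rho>0 = (2 ^ 2 ^ d * (12 * e powr (1 / 4 ^ d))) powr (1 / 2 ^ d) + 3 * \<eta>"
  define T where "T = N * (k choose d)"
  define \<kappa> where "\<kappa> = 2 * real T * (real m * \<rho>0)"
  note par = parameter_bounds[OF d m k N(1) L n, folded M_def, folded \<eta>_def, folded e_def, folded \<rho>0_def,
      folded T_def, folded \<kappa>_def]
  have \<rho>0: "0 \<le> \<rho>0" by (simp add: \<rho>0_def \<eta>_def)
  have "finite A" using A(1) m by (intro card_ge_0_finite) simp
  have fin: "finite (set_pmf P)" by (rule random_array_finite[OF A(2) \<open>finite A\<close>])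
  have "1 * (N * k) \<le> M * (N * k)" using par(1) by (intro mult_le_mono) auto
  then have Nk: "N * k \<le> n" using par(2) by linarith
  define U where "U = nsubsets {1..N * k} d"
  have inA: "\<omega> s \<in> A" if "\<omega> \<in> set_pmf P" "s \<in> U" for \<omega> s
  proof -
    have "s \<in> nsubsets {1..n} d" using that(2) Nk by (auto simp: U_def nsubsets_def)
    then show ?thesis using A(2) that(1) by (auto simp: random_array_def)
  qed
  have dec: "\<bar>measure_pmf.prob P {\<omega>. \<forall>s\<in>F. \<omega> s = a s}
      - measure_pmf.prob P {\<omega>. \<omega> s0 = a s0} * measure_pmf.prob P {\<omega>. \<forall>s\<in>F - {s0}. \<omega> s = a s}\<bar> \<le> m * \<rho>0"
    if F: "F \<subseteq> U" "s0 \<in> F" and a: "a s0 \<in> A" for F s0 a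
    unfolding A(1)[symmetric]
  proof (rule decouple_all[where S = S and U = U and a = a])
    fix F s0 and a :: "nat set \<Rightarrow> 'a"
    assume F: "F \<subseteq> U" "s0 \<in> F" and a: "a s0 \<in> S"
    show "\<bar>measure_pmf.prob P {\<omega>. \<forall>s\<in>F. \<omega> s = a s}
      - measure_pmf.prob P {\<omega>. \<omega> s0 = a s0} * measure_pmf.prob P {\<omega>. \<forall>s\<in>F - {s0}. \<omega> s = a s}\<bar> \<le> \<rho>0"
      unfolding \<rho>0_def
    proof (rule decouple[OF sp[folded \<eta>_def] fin d par(4) par(1) par(2) par(3) F[unfolded U_def] _ e_def par(5)])
      show "measure_pmf.prob P {\<omega>. \<forall>s\<in>Box n d. \<omega> s = a s0}
        \<le> (\<Prod>s\<in>Box n d. measure_pmf.prob P {\<omega>. \<omega> s = a s0}) + \<eta>"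
        using S(3)[OF a] by (simp add: \<eta>_def abs_le_iff)
    qed
  qed (use fin \<open>finite A\<close> S(1,2) inA F a \<rho>0 in auto)
  have ind: "\<bar>measure_pmf.prob P {\<omega>. \<forall>s\<in>F. \<omega> s = a s} - (\<Prod>s\<in>F. measure_pmf.prob P {\<omega>. \<omega> s = a s})\<bar>
      \<le> card F * (m * \<rho>0)" if F: "F \<subseteq> U" and a: "\<And>s. s \<in> F \<Longrightarrow> a s \<in> A" for F a
  proof (rule approx_independent[of F])
    show "finite F" using F by (rule finite_subset) (simp add: U_def finite_nsubsets)
    fix F' s0 assume "F' \<subseteq> F" "s0 \<in> F'"
    then show "\<bar>measure_pmf.prob P {\<omega>. \<forall>s\<in>F'. \<omega> s = a s}
      - measure_pmf.prob P {\<omega>. \<omega> s0 = a s0} * measure_pmf.prob P {\<omega>. \<forall>s\<in>F' - {s0}. \<omega> s = a s}\<bar> \<le> m * \<rho>0"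
      using F a by (intro dec) auto
  qed simp
  define B where "B j = nsubsets (block k j) d" for j
  have finB: "finite (B j)" for j by (simp add: B_def block_def finite_nsubsets)
  have cardB: "card (B j) = k choose d" for j by (simp add: B_def block_def card_nsubsets)
  have BU: "B j \<subseteq> U" if "j < N" for j
    using block_subset[OF that, of k] by (auto simp: B_def U_def nsubsets_def)
  have Bdisj: "B i \<inter> B j = {}" if "i \<noteq> j" for i j
  proof (intro equals0I)
    fix s assume "s \<in> B i \<inter> B j"
    then have "s \<subseteq> block k i \<inter> block k j" "card s = d" by (auto simp: B_def nsubsets_def)
    \<comment> \<open>As \<open>1 \<le> d\<close>, the empty set, the only common subset of two
      disjoint blocks, is not an index set.\<close>
    then show False using block_disjoint[OF that, of k] d by simp
  qed
  define R where "R j = PiE (B j) (\<lambda>_. A)" for j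
  have cardR: "card (R j) = m ^ (k choose d)" for j
    using A(1) by (simp add: R_def card_PiE finB cardB)
  define Y where "Y j = (restr_arr (block k j) d :: (nat set \<Rightarrow> 'a) \<Rightarrow> _)" for j
  \<comment> \<open>Extensionality of \<open>y\<close> reduces equality of arrays to the finitely
    many entries in the block.\<close>
  have Yeq: "Y j \<omega> = y \<longleftrightarrow> (\<forall>s\<in>B j. \<omega> s = y s)" if "y \<in> R j" for j \<omega> y
  proof -
    have "y s = undefined" if "s \<notin> B j" for s using that \<open>y \<in> R j\<close> by (auto simp: R_def)
    then show ?thesis by (auto simp: Y_def restr_arr_def B_def fun_eq_iff)
  qed
  have "(\<Sum>j<N. measure_pmf.expectation P (\<lambda>\<omega>. \<bar>cond_mean P f (Y j) (Y j \<omega>)\<bar>)) \<le> N * \<epsilon> ^ 3"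
  proof (rule sum_cond_mean_L1[OF fin, of N R Y \<kappa> p "\<epsilon> ^ 3"])
    show "finite (R j)" for j unfolding R_def by (intro finite_PiE finB \<open>finite A\<close>)
    show "Y j \<omega> \<in> R j" if "j < N" "\<omega> \<in> set_pmf P" for j \<omega>
      using inA[OF that(2)] BU[OF that(1)] by (auto simp: R_def Y_def B_def restr_arr_def)
    show "0 \<le> \<kappa>" using \<rho>0 by (simp add: \<kappa>_def)
    show "(\<Prod>j<N. real (card (R j))) * \<kappa> * exp (2 * real N) \<le> 1"
      using par(7) by (simp add: cardR)
    show "\<bar>measure_pmf.prob P {\<omega>. \<forall>j<N. Y j \<omega> = y j} - (\<Prod>j<N. measure_pmf.prob P {\<omega>. Y j \<omega> = y j})\<bar> \<le> \<kappa>"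
      if y: "\<And>j. j < N \<Longrightarrow> y j \<in> R j" for y
    proof -
      have "\<bar>measure_pmf.prob P {\<omega>. \<forall>j<N. \<forall>s\<in>B j. \<omega> s = y j s}
         - (\<Prod>j<N. measure_pmf.prob P {\<omega>. \<forall>s\<in>B j. \<omega> s = y j s})\<bar> \<le> 2 * (\<Sum>j<N. card (B j)) * (m * \<rho>0)"
        by (rule approx_independent_blocks[where B = B and y = y and U = U and A = A, OF ind BU finB Bdisj]) (use y in \<open>auto simp: R_def\<close>)
      moreover have "{\<omega>. \<forall>j<N. Y j \<omega> = y j} = {\<omega>. \<forall>j<N. \<forall>s\<in>B j. \<omega> s = y j s}"
        using Yeq[OF y] by blast
      moreover have "(\<Prod>j<N. measure_pmf.prob P {\<omega>. Y j \<omega> = y j}) = (\<Prod>j<N. measure_pmf.prob P {\<omega>. \<forall>s\<in>B j. \<omega> s = y j s})"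
        using Yeq[OF y] by (intro prod.cong) auto
      ultimately show ?thesis by (simp add: \<kappa>_def T_def cardB)
    qed
  qed (use p \<epsilon> N f in \<open>auto intro: power_le_one\<close>)
  then show ?thesis by (simp add: Y_def)
qed

section \<open>Choice of the interval and of the good set\<close>

theorem theorem7p4:
  fixes d m k n :: nat and p \<epsilon> :: real
    and V :: "'v set" and lam :: "'v pmf"
    and Xs :: "'v \<Rightarrow> 'a set" and X :: "'v \<Rightarrow> (nat set \<Rightarrow> 'a) pmf"
    and f :: "'v \<Rightarrow> (nat set \<Rightarrow> 'a) \<Rightarrow> real"
  assumes "d \<ge> 1" and "m \<ge> 2"
    and "1 < p" and "p \<le> 2"
    and "0 < \<epsilon>" and "\<epsilon> \<le> 1"
    and "k \<ge> d"
    and "real n \<ge> exp (24 * real d * ln (real m) / ((\<epsilon>^3/4)^(4*d) * (p-1)^d) * real k ^ d)"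
    and "finite V" and "set_pmf lam \<subseteq> V"
    and "\<And>v. v \<in> V \<Longrightarrow> card (Xs v) = m"
    and "\<And>v. v \<in> V \<Longrightarrow> random_array n d (Xs v) (X v)"
    and "\<And>v. v \<in> V \<Longrightarrow> spreadable
           (1 / exp (24 * real d * ln (real m) / ((\<epsilon>^3/4)^(4*d) * (p-1)^d) * real k ^ d)) n d (X v)"
    and "\<And>v. v \<in> V \<Longrightarrow> \<exists>S \<subseteq> Xs v. card S = card (Xs v) - 1 \<and>
           (\<forall>a\<in>S. \<bar>measure_pmf.prob (X v) {\<omega>. \<forall>s\<in>Box n d. \<omega> s = a}
                   - (\<Prod>s\<in>Box n d. measure_pmf.prob (X v) {\<omega>. \<omega> s = a})\<bar>
                 \<le> 1 / exp (24 * real d * ln (real m) / ((\<epsilon>^3/4)^(4*d) * (p-1)^d) * real k ^ d))"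
    and "\<And>v. v \<in> V \<Longrightarrow> measure_pmf.expectation (X v) (f v) = 0"
    and "\<And>v. v \<in> V \<Longrightarrow> (measure_pmf.expectation (X v) (\<lambda>\<omega>. \<bar>f v \<omega>\<bar> powr p)) powr (1/p) = 1"
  shows "\<exists>G \<subseteq> V. measure_pmf.prob lam G \<ge> 1 - \<epsilon> \<and>
           (\<exists>I a. I = {a..<a+k} \<and> I \<subseteq> {1..n} \<and>
              (\<forall>v\<in>G. \<forall>J \<subseteq> I. card J \<ge> d \<longrightarrow>
                 measure_pmf.prob (X v)
                   {\<omega>. \<bar>cond_exp_disc (X v) (f v) (restr_arr J d) \<omega>\<bar> \<le> \<epsilon>} \<ge> 1 - \<epsilon>))"
proof -
  define L where "L = 24 * real d * ln (real m) / ((\<epsilon>^3/4)^(4*d) * (p-1)^d) * real k ^ d"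
  note n = assms(8)[folded L_def] and sp = assms(13)[folded L_def] and box = assms(14)[folded L_def]
  \<comment> \<open>\<open>p / (p - 1)\<close> is the conjugate exponent, and
    \<open>\<epsilon> ^ 3\<close> is the target for the average over the blocks.\<close>
  define r where "r = 2 * (p / (p - 1)) / (\<epsilon> ^ 3)\<^sup>2"
  define N where "N = nat \<lceil>r\<rceil>"
  have "0 < r" using assms(3,5) by (simp add: r_def)
  then have N: "r \<le> N" "real N \<le> r + 1" "1 \<le> N" by (simp_all add: N_def) linarith+
  have L: "150 * 8 ^ d * (d * N * k ^ d * ln m) \<le> L"
    unfolding L_def by (rule exponent_bound) (use assms N in \<open>auto simp: r_def\<close>)
  define Y where "Y j = (restr_arr (block k j) d :: (nat set \<Rightarrow> 'a) \<Rightarrow> _)" for j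
  define \<alpha> where "\<alpha> j v = measure_pmf.expectation (X v) (\<lambda>\<omega>. \<bar>cond_mean (X v) (f v) (Y j) (Y j \<omega>)\<bar>)" for j v
  have finX: "finite (set_pmf (X v))" if "v \<in> V" for v
    using assms(11,12)[OF that] assms(2) by (intro random_array_finite[where A = "Xs v"] card_ge_0_finite) auto
  have \<alpha>0: "0 \<le> \<alpha> j v" for j v unfolding \<alpha>_def by (rule integral_nonneg_AE) simp
  have sum\<alpha>: "(\<Sum>j<N. \<alpha> j v) \<le> N * \<epsilon> ^ 3" if v: "v \<in> V" for v
  proof -
    obtain S where S: "S \<subseteq> Xs v" "card S = card (Xs v) - 1"
      "\<And>a. a \<in> S \<Longrightarrow> \<bar>measure_pmf.prob (X v) {\<omega>. \<forall>s\<in>Box n d. \<omega> s = a}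
          - (\<Prod>s\<in>Box n d. measure_pmf.prob (X v) {\<omega>. \<omega> s = a})\<bar> \<le> 1 / exp L"
      using box[OF v] by blast
    have "measure_pmf.expectation (X v) (\<lambda>\<omega>. \<bar>f v \<omega>\<bar> powr p)
        = (measure_pmf.expectation (X v) (\<lambda>\<omega>. \<bar>f v \<omega>\<bar> powr p) powr (1 / p)) powr p"
      using assms(3) by (simp add: powr_powr integral_nonneg_AE)
    then have "measure_pmf.expectation (X v) (\<lambda>\<omega>. \<bar>f v \<omega>\<bar> powr p) = 1"
      unfolding assms(16)[OF v] by simp
    then show ?thesis
      unfolding \<alpha>_def Y_def
      using assms N(1,3) unfolding r_def
      by (intro block_conditioning[OF _ _ _ _ _ _ _ _ _ L n assms(11,12)[OF v] sp[OF v] S assms(15)[OF v]]) auto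
  qed
  interpret lam: averaging "set_pmf lam" "measure_pmf.expectation lam"
    by (rule averaging_pmf) (use assms(9,10) finite_subset in blast)
  have "(\<Sum>j<N. measure_pmf.expectation lam (\<alpha> j)) \<le> N * \<epsilon> ^ 3"
    unfolding lam.sum[symmetric] using sum\<alpha> assms(10) by (intro lam.upper) auto
  \<comment> \<open>Some block does no worse than the average over the blocks, and its index no
    longer depends on \<open>v\<close>.\<close>
  then obtain j where j: "j < N" "measure_pmf.expectation lam (\<alpha> j) \<le> \<epsilon> ^ 3"
    using sum_strict_mono[of "{..<N}" "\<lambda>_. \<epsilon> ^ 3" "\<lambda>j. measure_pmf.expectation lam (\<alpha> j)"] N(3)
    by (fastforce simp: not_le lessThan_empty_iff)
  \<comment> \<open>The threshold comes from
    \<open>\<epsilon> ^ 3 = \<epsilon> * \<epsilon>\<^sup>2\<close> in Markov's inequality over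
    \<open>v\<close>; a second use over the outcomes, in \<open>good\<close>, splits
    \<open>\<epsilon>\<^sup>2\<close> as \<open>\<epsilon> * \<epsilon>\<close>.\<close>
  define G where "G = {v\<in>V. \<alpha> j v \<le> \<epsilon>\<^sup>2}"
  have "1 - \<epsilon> \<le> measure_pmf.prob lam {v. \<alpha> j v \<le> \<epsilon>\<^sup>2}"
    using j(2) \<alpha>0 assms(5,9,10)
    by (intro markov_prob) (auto intro: finite_subset simp: power3_eq_cube power2_eq_square)
  also have "\<dots> = measure_pmf.prob lam G"
    using assms(10) by (intro measure_eq_AE) (auto simp: AE_measure_pmf_iff G_def)
  finally have G: "1 - \<epsilon> \<le> measure_pmf.prob lam G" .
  have good: "1 - \<epsilon> \<le> measure_pmf.prob (X v) {\<omega>. \<bar>cond_exp_disc (X v) (f v) (restr_arr J d) \<omega>\<bar> \<le> \<epsilon>}"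
    if v: "v \<in> G" and J: "J \<subseteq> block k j" for v J
  proof -
    have vV: "v \<in> V" "\<alpha> j v \<le> \<epsilon>\<^sup>2" using v by (auto simp: G_def)
    define g where "g = (restr_arr J d :: (nat set \<Rightarrow> 'a) \<Rightarrow> _)"
    \<comment> \<open>As \<open>J\<close> lies in the block, the array on \<open>J\<close> is a
      function of the array on the block.\<close>
    have gY: "g = (\<lambda>\<omega>. g (Y j \<omega>))"
      using J by (auto simp: g_def Y_def restr_arr_def nsubsets_def fun_eq_iff)
    have "measure_pmf.expectation (X v) (\<lambda>\<omega>. \<bar>cond_exp_disc (X v) (f v) g \<omega>\<bar>)
        = measure_pmf.expectation (X v) (\<lambda>\<omega>. \<bar>cond_mean (X v) (f v) (\<lambda>\<omega>. g (Y j \<omega>)) (g (Y j \<omega>))\<bar>)"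
      by (simp add: cond_exp_disc_eq gY[symmetric] fun_cong[OF gY, symmetric])
    also have "\<dots> \<le> \<alpha> j v" unfolding \<alpha>_def by (rule cond_mean_contraction[OF finX[OF vV(1)]])
    also have "\<dots> \<le> \<epsilon> * \<epsilon>" using vV by (simp add: power2_eq_square)
    finally show ?thesis
      unfolding g_def[symmetric] using assms(5) by (intro markov_prob finX vV(1)) auto
  qed
  have "N * k \<le> n"
  proof -
    note par = parameter_bounds[OF assms(1,2,7) N(3) L n]
    have "1 * (N * k) \<le> (n div (N * k)) * (N * k)" using par(1) by (intro mult_le_mono) auto
    then show ?thesis using par(2) by linarith
  qed
  then have I: "block k j \<subseteq> {1..n}" using block_subset[OF j(1), of k] by auto
  show ?thesis
  proof (intro exI[of _ G] conjI exI[of _ "block k j"] exI[of _ "j * k + 1"] ballI allI impI)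
    show "block k j = {j * k + 1..<j * k + 1 + k}" by (simp add: block_def)
  qed (use G I good in \<open>auto simp: G_def\<close>)
qed

end
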